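(* Let $P, Q$ be 4-polytopes and let $\varphi:\mathscr{F}_1^2(P) \to \mathscr{F}_1^2(Q)$ be an isomorphism of posets. Then $\varphi$ extends to an isomorphism of posets $\mathscr{F}(P) \to \mathscr{F}(Q)$.
   Context: A $d$-polytope is the convex hull of a finite point set in $\mathbb{R}^d$ whose affine hull is $\mathbb{R}^d$. A face of a $d$-polytope $P$ is either $P$ itself or a set $P \cap H$, where $H \subset \mathbb{R}^d$ is a hyperplane (codimension one affine subspace) that does not intersect the interior of $P$ (so the empty set is a face). For $0 \le k < d$, a $k$-face is a face whose affine hull has dimension $k$. The face poset $\mathscr{F}(P)$ is the set of all faces of $P$, partially ordered by containment, and $\mathscr{F}^k(P)$ denotes the set of $k$-faces. For $0 \le a \le b < d$, the $(a,b)$-skeleton is $\mathscr{F}_a^b(P) := \bigcup_{k=a}^b \mathscr{F}^k(P)$ with the partial order induced from $\mathscr{F}(P)$. Thus for a 4-polytope, $\mathscr{F}_1^2(P)$ is the poset of its edges (1-faces) and ridges (2-faces) under containment. *)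

theory Defs
  imports "HOL-Analysis.Analysis"
begin

definition full_polytope :: "'a::euclidean_space set \<Rightarrow> bool"
  where "full_polytope P \<longleftrightarrow> polytope P \<and> affine hull P = UNIV"

definition hyperplane :: "'a::euclidean_space set \<Rightarrow> bool"
  where "hyperplane H \<longleftrightarrow> affine H \<and> aff_dim H = int DIM('a) - 1"

text \<open>This is the supporting-hyperplane definition of a face, meant for full-dimensional polytopes;
  there it agrees with \<^const>\<open>face_of\<close>, see \<open>faces_eq_face_of\<close> below.\<close>

definition faces :: "'a::euclidean_space set \<Rightarrow> 'a set set"
  where "faces P = insert P {P \<inter> H | H. hyperplane H \<and> H \<inter> interior P = {}}"

text \<open>\<^const>\<open>aff_dim\<close> of a set is the dimension of its affine hull, and is \<open>-1\<close> for the
  empty set, so the empty face is not a \<open>k\<close>-face for any natural \<open>k\<close>.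
  \<open>k_faces\<close> and \<open>skeleton\<close> are meant for dimensions below that of the ambient space.\<close>

definition k_faces :: "nat \<Rightarrow> 'a::euclidean_space set \<Rightarrow> 'a set set"
  where "k_faces k P = {F \<in> faces P. aff_dim F = int k}"

definition skeleton :: "nat \<Rightarrow> nat \<Rightarrow> 'a::euclidean_space set \<Rightarrow> 'a set set"
  where "skeleton a b P = (\<Union>k\<in>{a..b}. k_faces k P)"

text \<open>A family of sets is regarded as a poset under \<open>\<subseteq>\<close>, which is \<open>\<le>\<close> on sets.\<close>

definition poset_iso :: "'a::order set \<Rightarrow> 'b::order set \<Rightarrow> ('a \<Rightarrow> 'b) \<Rightarrow> bool"
  where "poset_iso A B f \<longleftrightarrow>
    bij_betw f A B \<and> (\<forall>x\<in>A. \<forall>y\<in>A. x \<le> y \<longleftrightarrow> f x \<le> f y)"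

lemma hyperplane_iff:
  fixes H :: "'a::euclidean_space set"
  shows "hyperplane H \<longleftrightarrow> (\<exists>a b. a \<noteq> 0 \<and> H = {x. a \<bullet> x = b})"
proof
  assume "hyperplane H"
  then have H: "affine hull H = H" "aff_dim H = int DIM('a) - 1"
    by (auto simp: hyperplane_def affine_hull_eq)
  from H(2) obtain a b where "a \<noteq> 0" "affine hull H = {x. a \<bullet> x = b}"
    using aff_dim_eq_hyperplane[of H] by (auto simp: of_nat_diff DIM_positive Suc_leI)
  then show "\<exists>a b. a \<noteq> 0 \<and> H = {x. a \<bullet> x = b}"
    unfolding H(1) by blast
next
  assume "\<exists>a b. a \<noteq> 0 \<and> H = {x. a \<bullet> x = b}"
  then show "hyperplane H"
    by (auto simp: hyperplane_def affine_hyperplane)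
qed

lemma faces_eq_face_of:
  fixes P :: "'a::euclidean_space set"
  assumes "full_polytope P"
  shows "faces P = {F. F face_of P}"
proof -
  have poly: "polytope P" and aff: "affine hull P = UNIV"
    using assms by (auto simp: full_polytope_def)
  have cvx: "convex P" and clo: "closed P" and bdd: "bounded P"
    using poly by (auto simp: polytope_imp_convex polytope_imp_closed polytope_imp_bounded)
  have ri: "rel_interior P = interior P"
    using aff by (simp add: rel_interior_interior)
  have ne: "P \<noteq> {}" using aff by auto
  then have intne: "interior P \<noteq> {}"
    using ri cvx rel_interior_eq_empty by metis
  have clint: "closure (interior P) = P"
    using convex_closure_interior[OF cvx intne] clo by simp
  have "F face_of P" if Fin: "F \<in> faces P" for F
  proof -
    consider "F = P" | H where "F = P \<inter> H" "hyperplane H" "H \<inter> interior P = {}"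
      using Fin unfolding faces_def by blast
    then show ?thesis
    proof cases
      case 1
      then show ?thesis using cvx by (simp add: face_of_refl)
    next
      case 2
      then obtain a b where a: "a \<noteq> 0" "H = {x. a \<bullet> x = b}"
        by (auto simp: hyperplane_iff)
      have con: "connected (interior P)"
        using cvx by (simp add: convex_interior convex_connected)
      have "(\<forall>x\<in>interior P. a \<bullet> x \<le> b) \<or> (\<forall>x\<in>interior P. a \<bullet> x \<ge> b)"
      proof (rule ccontr)
        assume "\<not> ?thesis"
        then obtain x y where xy: "x \<in> interior P" "y \<in> interior P" "a \<bullet> x \<ge> b" "a \<bullet> y \<le> b"
          by force
        then obtain z where "z \<in> interior P" "a \<bullet> z = b"
          using connected_ivt_hyperplane[OF con xy(2,1)] by blast
        then show False using a 2 by auto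
      qed
      then have "P \<subseteq> {x. a \<bullet> x \<le> b} \<or> P \<subseteq> {x. a \<bullet> x \<ge> b}"
        using closure_minimal[of "interior P" "{x. a \<bullet> x \<le> b}"]
          closure_minimal[of "interior P" "{x. a \<bullet> x \<ge> b}"]
        unfolding clint by (auto simp: closed_halfspace_le closed_halfspace_ge subset_iff)
      then show ?thesis
        using 2 a face_of_Int_supporting_hyperplane_le[OF cvx, where a = a and b = b]
          face_of_Int_supporting_hyperplane_ge[OF cvx, where a = a and b = b] by auto
    qed
  qed
  moreover have "F \<in> faces P" if F: "F face_of P" for F
  proof -
    have "F exposed_face_of P"
      using F poly exposed_face_of_polyhedron polytope_imp_polyhedron by blast
    then consider "F = {}" | "F = P" | a b where "F \<noteq> P" "a \<noteq> 0" "F = P \<inter> {x. a \<bullet> x = b}"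
      by (auto simp: exposed_face_of)
    then show ?thesis
    proof cases
      case 1
      obtain a :: 'a where a: "a \<in> Basis" using nonempty_Basis by blast
      obtain B where B: "\<And>x. x \<in> P \<Longrightarrow> norm x \<le> B" using bdd by (auto simp: bounded_iff)
      have "P \<inter> {x. a \<bullet> x = B + 1} = {}"
      proof -
        have "a \<bullet> x < B + 1" if "x \<in> P" for x
          using B[OF that] Basis_le_norm[OF a, of x] by (simp add: inner_commute)
        then show ?thesis by force
      qed
      moreover have "hyperplane {x. a \<bullet> x = B + 1}"
        using a nonzero_Basis hyperplane_iff by blast
      ultimately show ?thesis
        using 1 interior_subset[of P] unfolding faces_def by blast
    next
      case 2
      then show ?thesis by (simp add: faces_def)
    next
      case 3
      have "F \<inter> interior P = {}"
        using face_of_disjoint_rel_interior[OF F] 3 ri by simp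
      then have "{x. a \<bullet> x = b} \<inter> interior P = {}"
        using 3 interior_subset[of P] by blast
      moreover have "hyperplane {x. a \<bullet> x = b}" using 3 hyperplane_iff by blast
      ultimately show ?thesis using 3 unfolding faces_def by blast
    qed
  qed
  ultimately show ?thesis by blast
qed

end

theory Submission
  imports Defs
begin

text \<open>
  Vertices and facets are invisible in the poset of edges and 2-faces (called polygons below), so
  they have to be recovered from the incidences of edges and polygons. A vertex \<open>v\<close> is represented by
  its star, the set of edges that contain \<open>v\<close>. The core of the proof is the description \<open>star_like\<close> of
  the stars among all nonempty sets \<open>S\<close> of edges, valid in dimension at least 3:

  \<^item> every polygon contains no edge or exactly two edges of \<open>S\<close>;
  \<^item> the edges in \<open>S\<close> are connected via polygons;
  \<^item> the edges outside of \<open>S\<close> are connected via polygons that contain no edge of \<open>S\<close>.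

  For a star, the first condition says that a vertex of a polygon is on two edges of it, and the
  second one that the graph of the vertex figure is connected. The third one is
  \<open>antistar_connected\<close>. Conversely, the first condition makes \<open>S\<close> a cocycle modulo 2, and the
  2-skeleton of a polytope has no cohomology modulo 2 in degree 1, so \<open>S\<close> consists of the edges between
  a set of vertices and its complement (\<open>even_edge_set_is_cut\<close>). By the third condition all edges
  outside of \<open>S\<close> are on the same side of this cut. So some vertex has all its edges in \<open>S\<close>, and by the
  first two conditions \<open>S\<close> is the star of this vertex (\<open>star_like_is_star\<close>). As the conditions only
  speak about incidences, the given isomorphism maps stars to stars (\<open>vertex_transfer\<close>).

  All connectedness results come from the simplex algorithm: a vertex that does not minimise a linear
  functional has an edge along which the functional decreases (\<open>descent\<close>). This is applied to the
  polytope, to its faces, and to its vertex figures, which are realised as slices by a hyperplane.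

  In dimension 4, polar duality exchanges edges with polygons and vertices with facets. So the result
  about vertices, applied to the polar polytopes, recovers the facets (\<open>facet_transfer\<close>). Finally, two
  distinct nested faces other than the empty face and the polytope always have an edge or a polygon
  in between (\<open>skel_interpolates\<close>), so a bijection of the faces that respects incidence with edges and
  polygons is an isomorphism of the face posets.
\<close>

section \<open>Edges and polygons of a polytope\<close>

definition edges :: "'a::euclidean_space set \<Rightarrow> 'a set set"
  where "edges P = {e. e face_of P \<and> aff_dim e = 1}"

definition polygons :: "'a::euclidean_space set \<Rightarrow> 'a set set"
  where "polygons P = {G. G face_of P \<and> aff_dim G = 2}"

definition star :: "'a::euclidean_space set \<Rightarrow> 'a \<Rightarrow> 'a set set"
  where "star P v = {e \<in> edges P. v \<in> e}"

lemma finite_edges: "polytope P \<Longrightarrow> finite (edges P)"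
  by (rule finite_subset[OF _ finite_polytope_faces[of P]]) (auto simp: edges_def)

lemma finite_extreme_points:
  fixes P :: "'a::euclidean_space set"
  shows "polytope P \<Longrightarrow> finite {v. v extreme_point_of P}"
  by (simp add: finite_polyhedron_extreme_points polytope_imp_polyhedron)

lemma edges_of_face: "F face_of P \<Longrightarrow> edges F = {e \<in> edges P. e \<subseteq> F}"
  by (auto simp: edges_def face_of_face)

lemma polytope_dim1_segment:
  fixes e :: "'a::euclidean_space set"
  assumes "polytope e" "aff_dim e = 1"
  obtains v w where "v \<noteq> w" "e = closed_segment v w"
proof -
  have "e \<noteq> {}" using assms by auto
  then obtain v w where "e = closed_segment v w"
    using compact_convex_collinear_segment[of e] assms
    by (auto simp: collinear_aff_dim polytope_imp_compact polytope_imp_convex)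
  moreover from this have "v \<noteq> w" using assms by auto
  ultimately show ?thesis using that by blast
qed

lemma edge_ends:
  assumes "polytope P" "e \<in> edges P"
  obtains v w where "v \<noteq> w" "v extreme_point_of P" "w extreme_point_of P" "e = closed_segment v w"
proof -
  have e: "e face_of P" "aff_dim e = 1" using assms by (auto simp: edges_def)
  then obtain v w where vw: "v \<noteq> w" "e = closed_segment v w"
    using polytope_dim1_segment face_of_polytope_polytope assms by metis
  have "v extreme_point_of e" "w extreme_point_of e"
    using vw by (auto simp: extreme_point_of_segment)
  then show ?thesis using that vw extreme_point_of_face[OF e(1)] by blast
qed

lemma edge_other_end:
  assumes "polytope P" "e \<in> edges P" "v extreme_point_of P" "v \<in> e"
  obtains w where "w \<noteq> v" "w extreme_point_of P" "e = closed_segment v w"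
proof -
  obtain x y where xy: "x \<noteq> y" "x extreme_point_of P" "y extreme_point_of P" "e = closed_segment x y"
    using edge_ends assms by metis
  have "v extreme_point_of e"
    using assms extreme_point_of_face[of e P v] by (auto simp: edges_def)
  then have "v = x \<or> v = y" using xy by (simp add: extreme_point_of_segment)
  then show ?thesis using xy that by (metis closed_segment_commute)
qed

lemma edge_extreme_points:
  assumes "closed_segment v w \<in> edges P" "u extreme_point_of P" "u \<in> closed_segment v w"
  shows "u = v \<or> u = w"
  using assms extreme_point_of_face[of "closed_segment v w" P u]
  by (auto simp: edges_def extreme_point_of_segment)

lemma edge_segment_ends:
  assumes "closed_segment v w \<in> edges P"
  shows "v \<noteq> w" "v extreme_point_of P" "w extreme_point_of P"
proof -
  have e: "closed_segment v w face_of P" "aff_dim (closed_segment v w) = 1"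
    using assms by (auto simp: edges_def)
  show "v \<noteq> w" using e by auto
  show "v extreme_point_of P" "w extreme_point_of P"
    using extreme_point_of_face[OF e(1)] by (auto simp: extreme_point_of_segment)
qed

lemma polytope_extreme_hull:
  fixes P :: "'a::euclidean_space set"
  shows "polytope P \<Longrightarrow> P = convex hull {x. x extreme_point_of P}"
  by (simp add: Krein_Milman_Minkowski polytope_imp_compact polytope_imp_convex)

lemma polytope_subset_convex:
  fixes P :: "'a::euclidean_space set"
  assumes "polytope P" "\<And>x. x extreme_point_of P \<Longrightarrow> x \<in> C" "convex C"
  shows "P \<subseteq> C"
  by (subst polytope_extreme_hull[OF assms(1)], rule hull_minimal) (use assms in auto)

lemma minimum_attained_on_face:
  fixes P :: "'a::euclidean_space set" and c :: 'a
  assumes "polytope P" "P \<noteq> {}"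
  obtains m where "m \<in> P" "\<And>y. y \<in> P \<Longrightarrow> c \<bullet> m \<le> c \<bullet> y" "P \<inter> {x. c \<bullet> x = c \<bullet> m} face_of P"
proof -
  have "continuous_on P (\<lambda>x. c \<bullet> x)" by (intro continuous_intros)
  then obtain m where m: "m \<in> P" "\<forall>y\<in>P. c \<bullet> m \<le> c \<bullet> y"
    using continuous_attains_inf[OF polytope_imp_compact[OF assms(1)] assms(2)] by blast
  moreover have "P \<inter> {x. c \<bullet> x = c \<bullet> m} face_of P"
    using m assms polytope_imp_convex by (intro face_of_Int_supporting_hyperplane_ge) auto
  ultimately show ?thesis using that by blast
qed

lemma polytope_has_extreme_point:
  fixes P :: "'a::euclidean_space set"
  assumes "polytope P" "P \<noteq> {}" obtains x where "x extreme_point_of P"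
proof -
  have "P \<subseteq> {}" if "{x. x extreme_point_of P} = {}"
    by (rule polytope_subset_convex[OF assms(1)]) (use that in auto)
  then have "{x. x extreme_point_of P} \<noteq> {}" using assms(2) by auto
  then show ?thesis using that by blast
qed

lemma face_of_polytope_exposed:
  fixes P :: "'a::euclidean_space set"
  assumes "polytope P" "F face_of P"
  obtains a b where "P \<subseteq> {x. a \<bullet> x \<le> b}" "F = P \<inter> {x. a \<bullet> x = b}"
  using assms exposed_face_of_polyhedron[OF polytope_imp_polyhedron[OF assms(1)]]
  unfolding exposed_face_of_def by blast

lemma extreme_point_exposing:
  fixes P :: "'a::euclidean_space set"
  assumes "polytope P" "v extreme_point_of P"
  obtains a where "\<And>x. x \<in> P \<Longrightarrow> x \<noteq> v \<Longrightarrow> a \<bullet> x < a \<bullet> v"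
proof -
  have "{v} face_of P" using assms by (simp add: face_of_singleton)
  then obtain a b where ab: "P \<subseteq> {x. a \<bullet> x \<le> b}" "{v} = P \<inter> {x. a \<bullet> x = b}"
    using face_of_polytope_exposed assms by metis
  then have "b = a \<bullet> v" by auto
  then have "a \<bullet> x < a \<bullet> v" if "x \<in> P" "x \<noteq> v" for x
    using ab that by (auto simp: order_less_le)
  then show ?thesis using that by blast
qed

section \<open>Vertex figures\<close>

text \<open>The hyperplane \<open>H\<close> below separates \<open>v\<close> from all other extreme points, so the slice \<open>P \<inter> H\<close> is a
  vertex figure of \<open>P\<close> at \<open>v\<close>: the map \<open>F \<mapsto> F \<inter> H\<close> is an order isomorphism from the faces that contain
  \<open>v\<close> to the faces of the slice, and it lowers dimensions by one. The vertices and edges of the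
  slice thus stand for the edges and polygons of \<open>P\<close> at \<open>v\<close>.\<close>

locale vertex_figure =
  fixes P :: "'a::euclidean_space set" and v a :: 'a and \<beta> :: real
  assumes polytope: "polytope P" and vertex: "v extreme_point_of P"
    and above: "\<beta> < a \<bullet> v" and below: "\<And>y. y extreme_point_of P \<Longrightarrow> y \<noteq> v \<Longrightarrow> a \<bullet> y < \<beta>"
begin

definition H :: "'a set" where "H = {y. a \<bullet> y = \<beta>}"

lemma convex_H: "convex H" by (simp add: H_def convex_hyperplane)

lemma v_in: "v \<in> P" using vertex by (simp add: extreme_point_of_def)

lemma polytope_slice: "polytope (P \<inter> H)"
  unfolding H_def by (simp add: polytope_Int_polyhedron polytope polyhedron_hyperplane)

lemma cut_point:
  assumes "a \<bullet> y < \<beta>"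
  obtains l where "0 < l" "l < 1" "v + l *\<^sub>R (y - v) \<in> H"
proof
  let ?l = "(a \<bullet> v - \<beta>) / (a \<bullet> v - a \<bullet> y)"
  have d: "a \<bullet> v - a \<bullet> y > 0" using assms above by simp
  show "0 < ?l" "?l < 1" using d assms above by (auto simp: field_simps)
  have "a \<bullet> (v + ?l *\<^sub>R (y - v)) = a \<bullet> v - ?l * (a \<bullet> v - a \<bullet> y)"
    by (simp only: inner_add_right inner_scaleR_right inner_diff_right) (simp add: right_diff_distrib)
  also have "\<dots> = \<beta>" using d by simp
  finally show "v + ?l *\<^sub>R (y - v) \<in> H" by (simp add: H_def)
qed

lemma slice_face: "F face_of P \<Longrightarrow> F \<inter> H face_of P \<inter> H"
  by (rule face_of_slice[OF _ convex_H])

text \<open>An extreme point of \<open>F\<close> other than \<open>v\<close> lies on the line through \<open>v\<close> and the point where its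
  segment to \<open>v\<close> crosses \<open>H\<close>. This makes dimension and inclusion of faces at \<open>v\<close> readable from
  their slices.\<close>

lemma face_subset_cone:
  assumes F: "F face_of P" "v \<in> F"
  shows "F \<subseteq> affine hull (insert v (F \<inter> H))"
proof (rule polytope_subset_convex)
  show "polytope F" using F face_of_polytope_polytope polytope by blast
  show "convex (affine hull (insert v (F \<inter> H)))" by (simp add: affine_imp_convex)
  fix y assume y: "y extreme_point_of F"
  then have yP: "y extreme_point_of P" "y \<in> F" using F extreme_point_of_face by blast+
  show "y \<in> affine hull (insert v (F \<inter> H))"
  proof (cases "y = v")
    case True then show ?thesis by (simp add: hull_inc)
  next
    case False
    then obtain l where l: "0 < l" "l < 1" "v + l *\<^sub>R (y - v) \<in> H"
      using cut_point below yP by blast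
    let ?q = "v + l *\<^sub>R (y - v)"
    have "?q \<in> F"
      using convexD_alt[OF face_of_imp_convex[OF F(1)] F(2) yP(2), of l] l
      by (simp add: algebra_simps)
    then have q: "?q \<in> affine hull (insert v (F \<inter> H))" using l by (simp add: hull_inc)
    have "(1 - 1/l) *\<^sub>R v + (1/l) *\<^sub>R ?q \<in> affine hull (insert v (F \<inter> H))"
      using q by (intro mem_affine[OF affine_affine_hull]) (auto simp: hull_inc)
    also have "(1 - 1/l) *\<^sub>R v + (1/l) *\<^sub>R ?q = y"
      using l by (simp add: algebra_simps)
    finally show ?thesis .
  qed
qed

lemma slice_dim:
  assumes F: "F face_of P" "v \<in> F"
  shows "aff_dim (F \<inter> H) = aff_dim F - 1"
proof -
  have "affine hull (F \<inter> H) \<subseteq> H"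
    by (rule hull_minimal) (auto simp: H_def affine_hyperplane)
  then have "v \<notin> affine hull (F \<inter> H)" using above by (auto simp: H_def)
  then have "aff_dim (insert v (F \<inter> H)) = aff_dim (F \<inter> H) + 1" by (simp add: aff_dim_insert)
  moreover have "aff_dim (insert v (F \<inter> H)) = aff_dim F"
  proof (rule antisym)
    show "aff_dim (insert v (F \<inter> H)) \<le> aff_dim F" using F by (intro aff_dim_subset) auto
    show "aff_dim F \<le> aff_dim (insert v (F \<inter> H))"
      using aff_dim_subset[OF face_subset_cone[OF F]] by simp
  qed
  ultimately show ?thesis by simp
qed

lemma slice_mono:
  assumes F: "F face_of P" "v \<in> F" and F': "F' face_of P" "v \<in> F'"
    and sub: "F \<inter> H \<subseteq> F'"
  shows "F \<subseteq> F'"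
proof -
  have "F \<subseteq> affine hull (insert v (F \<inter> H))" by (rule face_subset_cone[OF F])
  also have "\<dots> \<subseteq> affine hull F'" using sub F' by (intro hull_mono) auto
  finally have "F \<subseteq> affine hull F' \<inter> P" using F face_of_imp_subset by blast
  also have "\<dots> = F'"
    using face_of_imp_eq_affine_Int[OF polytope_imp_convex[OF polytope] F'(1)] by blast
  finally show ?thesis .
qed

text \<open>The smallest face \<open>F\<close> of \<open>P\<close> that contains a relatively interior point \<open>z\<close> of \<open>X\<close> has \<open>z\<close> in its own
  relative interior. So \<open>X\<close> and \<open>F \<inter> H\<close> are convex subsets of the slice with a common relatively
  interior point, and each is contained in the other because \<open>X\<close> and \<open>F\<close> are faces.\<close>

lemma slice_face_lift:
  assumes X: "X face_of P \<inter> H" "X \<noteq> {}"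
  obtains F where "F face_of P" "v \<in> F" "X = F \<inter> H"
proof -
  have XP: "X \<subseteq> P" "X \<subseteq> H" using X face_of_imp_subset by blast+
  have "convex X" using X face_of_imp_convex by blast
  then obtain z where z: "z \<in> rel_interior X" using X rel_interior_eq_empty by blast
  then have zX: "z \<in> X" using rel_interior_subset by blast
  define F where "F = \<Inter>{F. F face_of P \<and> z \<in> F}"
  have F: "F face_of P" unfolding F_def
    using zX XP face_of_refl polytope_imp_convex[OF polytope] by (intro face_of_Inter) auto
  have Fmin: "F \<subseteq> F'" if "F' face_of P" "z \<in> F'" for F' using that by (auto simp: F_def)
  have zF: "z \<in> F" by (auto simp: F_def)
  have pF: "polytope F" using F face_of_polytope_polytope polytope by blast
  have zri: "z \<in> rel_interior F"
  proof (rule ccontr)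
    assume "\<not> ?thesis"
    then obtain F' where F': "F' facet_of F" "z \<in> F'"
      using rel_interior_of_polyhedron[OF polytope_imp_polyhedron[OF pF]] zF by auto
    then have "F' face_of P" using F face_of_trans facet_of_imp_face_of by blast
    then have "F' = F" using Fmin F' facet_of_imp_subset by blast
    then show False using F' by simp
  qed
  have "X \<subseteq> F" using subset_of_face_of[OF F XP(1)] z zF by blast
  moreover have "F \<inter> H \<subseteq> X"
  proof (rule subset_of_face_of[OF X(1)])
    show "F \<inter> H \<subseteq> P \<inter> H" using F face_of_imp_subset by blast
    obtain \<epsilon> where \<epsilon>: "\<epsilon> > 0" "ball z \<epsilon> \<inter> affine hull F \<subseteq> F"
      using zri by (auto simp: mem_rel_interior_ball)
    have "affine hull (F \<inter> H) \<subseteq> affine hull F" by (rule hull_mono) simp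
    moreover have "affine hull (F \<inter> H) \<subseteq> H"
      by (rule hull_minimal) (auto simp: H_def affine_hyperplane)
    ultimately have "z \<in> rel_interior (F \<inter> H)"
      using \<epsilon> zF zX XP by (auto simp: mem_rel_interior_ball)
    then show "X \<inter> rel_interior (F \<inter> H) \<noteq> {}" using zX by auto
  qed
  ultimately have "X = F \<inter> H" using XP by blast
  moreover have "v \<in> F"
  proof (rule ccontr)
    assume nv: "v \<notin> F"
    have "F \<subseteq> {y. a \<bullet> y < \<beta>}"
    proof (rule polytope_subset_convex[OF pF])
      fix x assume "x extreme_point_of F"
      then have "x extreme_point_of P" "x \<in> F" using F extreme_point_of_face by blast+
      then show "x \<in> {y. a \<bullet> y < \<beta>}" using below nv by auto
    qed (simp add: convex_halfspace_lt)
    then show False using zX XP zF by (auto simp: H_def)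
  qed
  ultimately show ?thesis using that F by blast
qed

text \<open>The crossing point \<open>q\<close> lies strictly beyond \<open>v\<close> on \<open>e\<close>, so it knows for every linear functional
  whether it decreases along \<open>e\<close>.\<close>

lemma edge_slice:
  assumes e: "e \<in> edges P" "v \<in> e"
  obtains q where "e \<inter> H = {q}" "q extreme_point_of P \<inter> H"
    "\<And>c. (c \<bullet> q < c \<bullet> v) = (\<exists>y\<in>e. c \<bullet> y < c \<bullet> v)"
proof -
  have ef: "e face_of P" "aff_dim e = 1" using e by (auto simp: edges_def)
  have "aff_dim (e \<inter> H) = 0" using slice_dim[OF ef(1) e(2)] ef by simp
  then obtain q where q: "e \<inter> H = {q}" using aff_dim_eq_0 by blast
  have "q extreme_point_of P \<inter> H" using slice_face[OF ef(1)] q by (simp add: face_of_singleton)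
  moreover obtain w where w: "w \<noteq> v" "e = closed_segment v w"
    using edge_other_end[OF polytope e(1) vertex e(2)] by metis
  have "q \<in> e" "q \<noteq> v" using q above by (auto simp: H_def)
  obtain l where lq: "q = (1 - l) *\<^sub>R v + l *\<^sub>R w" "0 \<le> l"
    using \<open>q \<in> e\<close> w by (auto simp: in_segment)
  then have l: "q = v + l *\<^sub>R (w - v)" "0 < l"
    using \<open>q \<noteq> v\<close> by (cases "l = 0"; simp add: algebra_simps)+
  have "c \<bullet> q < c \<bullet> v" if yc: "y \<in> e" "c \<bullet> y < c \<bullet> v" for c y
  proof -
    obtain m where "y = (1 - m) *\<^sub>R v + m *\<^sub>R w" and m0: "0 \<le> m"
      using yc(1) w by (auto simp: in_segment)
    then have m: "y = v + m *\<^sub>R (w - v)" by (simp add: algebra_simps)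
    have "m * (c \<bullet> (w - v)) < 0" using yc m by (simp add: inner_add_right)
    then have "c \<bullet> (w - v) < 0" using m0 by (simp add: mult_less_0_iff)
    then have "l * (c \<bullet> (w - v)) < 0" using l by (simp add: mult_less_0_iff)
    then show ?thesis using l by (simp add: inner_add_right)
  qed
  then have "\<And>c. (c \<bullet> q < c \<bullet> v) = (\<exists>y\<in>e. c \<bullet> y < c \<bullet> v)" using \<open>q \<in> e\<close> by blast
  ultimately show ?thesis using that q by blast
qed

lemma slice_vertex_edge:
  assumes q: "q extreme_point_of P \<inter> H"
  obtains e where "e \<in> edges P" "v \<in> e" "e \<inter> H = {q}"
proof -
  have "{q} face_of P \<inter> H" using q by (simp add: face_of_singleton)
  then obtain e where e: "e face_of P" "v \<in> e" "{q} = e \<inter> H" using slice_face_lift by blast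
  moreover have "aff_dim e = 1" using slice_dim[OF e(1,2)] unfolding e(3)[symmetric] by simp
  ultimately show ?thesis using that by (auto simp: edges_def)
qed

lemma slice_edge_polygon:
  assumes "X \<in> edges (P \<inter> H)"
  obtains G where "G \<in> polygons P" "v \<in> G" "X = G \<inter> H"
proof -
  have X: "X face_of P \<inter> H" "aff_dim X = 1" using assms by (auto simp: edges_def)
  then have "X \<noteq> {}" by auto
  then obtain G where G: "G face_of P" "v \<in> G" "X = G \<inter> H" using slice_face_lift X by blast
  moreover have "aff_dim G = 2" using slice_dim[OF G(1,2)] G(3) X by simp
  ultimately show ?thesis using that by (auto simp: polygons_def)
qed

end

lemma vertex_figure_exists:
  fixes P :: "'a::euclidean_space set"
  assumes "polytope P" "v extreme_point_of P"
  obtains a \<beta> where "vertex_figure P v a \<beta>"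
proof -
  obtain a where a: "\<And>x. x \<in> P \<Longrightarrow> x \<noteq> v \<Longrightarrow> a \<bullet> x < a \<bullet> v"
    using extreme_point_exposing assms by blast
  \<comment> \<open>The number \<open>a \<bullet> v - 1\<close> keeps \<open>W\<close> nonempty if \<open>v\<close> is the only extreme point.\<close>
  define W where "W = insert (a \<bullet> v - 1) ((\<bullet>) a ` ({x. x extreme_point_of P} - {v}))"
  have fin: "finite W" using finite_extreme_points assms by (auto simp: W_def)
  have "Max W < a \<bullet> v"
    using fin a by (subst Max_less_iff) (auto simp: W_def extreme_point_of_def)
  then obtain \<beta> where \<beta>: "Max W < \<beta>" "\<beta> < a \<bullet> v" using dense by blast
  have "vertex_figure P v a \<beta>"
  proof
    fix y assume "y extreme_point_of P" "y \<noteq> v"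
    then have "a \<bullet> y \<in> W" by (auto simp: W_def)
    then show "a \<bullet> y < \<beta>" using \<beta> Max_ge[OF fin] by fastforce
  qed (use assms \<beta> in auto)
  then show ?thesis using that by blast
qed

section \<open>Descending along edges\<close>

lemma (in vertex_figure) slice_has_lower_point:
  assumes z: "z \<in> P" "c \<bullet> z < c \<bullet> v"
  obtains m where "m \<in> P \<inter> H" "c \<bullet> m < c \<bullet> v"
proof -
  have "\<exists>y. y extreme_point_of P \<and> c \<bullet> y < c \<bullet> v"
  proof (rule ccontr)
    assume "\<not> ?thesis"
    then have "P \<subseteq> {y. c \<bullet> y \<ge> c \<bullet> v}"
      by (intro polytope_subset_convex[OF polytope]) (auto simp: convex_halfspace_ge not_less)
    then show False using z by auto
  qed
  then obtain y where y: "y extreme_point_of P" "c \<bullet> y < c \<bullet> v" by blast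
  then have yP: "y \<in> P" and "y \<noteq> v" by (auto simp: extreme_point_of_def)
  then obtain l where l: "0 < l" "l < 1" "v + l *\<^sub>R (y - v) \<in> H"
    using cut_point below y by blast
  have "v + l *\<^sub>R (y - v) \<in> P"
    using convexD_alt[OF polytope_imp_convex[OF polytope] v_in yP, of l] l
    by (simp add: algebra_simps)
  moreover have "l * (c \<bullet> (y - v)) < 0"
    using l y by (simp add: mult_less_0_iff inner_diff_right)
  then have "c \<bullet> (v + l *\<^sub>R (y - v)) < c \<bullet> v" by (simp add: inner_add_right)
  ultimately show ?thesis using that l by blast
qed

definition down_steps :: "'a::euclidean_space set \<Rightarrow> 'a \<Rightarrow> ('a \<times> 'a) set"
  where "down_steps P c = {(x, y). closed_segment x y \<in> edges P \<and> c \<bullet> y < c \<bullet> x}"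

text \<open>The minimum of \<open>c\<close> over the vertex figure at \<open>x\<close> is attained in an extreme point, which lies on an
  edge of \<open>P\<close> at \<open>x\<close>; \<open>c\<close> decreases along that edge.\<close>

lemma descent:
  fixes P :: "'a::euclidean_space set" and c :: 'a
  assumes P: "polytope P" and x: "x extreme_point_of P" and z: "z \<in> P" "c \<bullet> z < c \<bullet> x"
  obtains y where "(x, y) \<in> down_steps P c"
proof -
  obtain a \<beta> where "vertex_figure P x a \<beta>" using vertex_figure_exists P x by blast
  then interpret vf: vertex_figure P x a \<beta> .
  obtain m where m: "m \<in> P \<inter> vf.H" "c \<bullet> m < c \<bullet> x" using vf.slice_has_lower_point[OF z] .
  obtain p where p: "\<And>y. y \<in> P \<inter> vf.H \<Longrightarrow> c \<bullet> p \<le> c \<bullet> y" "p \<in> P \<inter> vf.H"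
    and pF: "(P \<inter> vf.H) \<inter> {y. c \<bullet> y = c \<bullet> p} face_of P \<inter> vf.H"
    using minimum_attained_on_face[OF vf.polytope_slice, of c] m(1) by (metis empty_iff)
  define F where "F = (P \<inter> vf.H) \<inter> {y. c \<bullet> y = c \<bullet> p}"
  have F: "F face_of P \<inter> vf.H" "F \<noteq> {}" using p pF by (auto simp: F_def)
  have "polytope F" using face_of_polytope_polytope[OF vf.polytope_slice F(1)] .
  then obtain q where q: "q extreme_point_of F" using polytope_has_extreme_point F by blast
  then have qq: "q extreme_point_of P \<inter> vf.H" "q \<in> F" using extreme_point_of_face[OF F(1)] by auto
  then have cq: "c \<bullet> q < c \<bullet> x" using p(1)[OF m(1)] qq(2) m by (simp add: F_def)
  obtain e where e: "e \<in> edges P" "x \<in> e" "e \<inter> vf.H = {q}"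
    using vf.slice_vertex_edge[OF qq(1)] .
  obtain w where w: "w \<noteq> x" "w extreme_point_of P" "e = closed_segment x w"
    using edge_other_end[OF P e(1) x e(2)] .
  have "c \<bullet> w < c \<bullet> x"
  proof (rule ccontr)
    assume "\<not> ?thesis"
    then have "closed_segment x w \<subseteq> {y. c \<bullet> y \<ge> c \<bullet> x}"
      by (intro closed_segment_subset) (auto simp: convex_halfspace_ge)
    then show False using e w cq by auto
  qed
  then show ?thesis using that e w by (auto simp: down_steps_def)
qed

lemma descends_to_minimum:
  fixes P :: "'a::euclidean_space set" and c :: 'a
  assumes P: "polytope P" and x: "x extreme_point_of P"
  obtains y where "(x, y) \<in> (down_steps P c)\<^sup>*" "y extreme_point_of P" "\<forall>z\<in>P. c \<bullet> y \<le> c \<bullet> z"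
proof -
  have "\<exists>y. (x, y) \<in> (down_steps P c)\<^sup>* \<and> y extreme_point_of P \<and> (\<forall>z\<in>P. c \<bullet> y \<le> c \<bullet> z)"
    using x
  proof (induction "card {u. u extreme_point_of P \<and> c \<bullet> u < c \<bullet> x}" arbitrary: x rule: less_induct)
    case less
    show ?case
    proof (cases "\<forall>z\<in>P. c \<bullet> x \<le> c \<bullet> z")
      case True then show ?thesis using less.prems by blast
    next
      case False
      then obtain z where "z \<in> P" "c \<bullet> z < c \<bullet> x" by fastforce
      then obtain y where y: "(x, y) \<in> down_steps P c" using descent[OF P less.prems] by blast
      then have yv: "y extreme_point_of P" "c \<bullet> y < c \<bullet> x"
        using edge_segment_ends by (auto simp: down_steps_def)
      have "card {u. u extreme_point_of P \<and> c \<bullet> u < c \<bullet> y} < card {u. u extreme_point_of P \<and> c \<bullet> u < c \<bullet> x}"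
        using yv by (intro psubset_card_mono finite_subset[OF _ finite_extreme_points[OF P]]) auto
      from less.hyps[OF this yv(1)] show ?thesis using y by (meson converse_rtrancl_into_rtrancl)
    qed
  qed
  then show ?thesis using that by blast
qed

text \<open>Every vertex below the level \<open>t\<close> can be joined to one fixed vertex \<open>m\<close>: descend to the face on
  which \<open>c\<close> is minimal, and inside that face descend with respect to \<open>-d\<close>, where \<open>d\<close> is a functional
  with its unique maximum in \<open>m\<close>. The second descent deals with a minimum that is attained in
  several vertices.\<close>

lemma graph_below_connected:
  fixes P :: "'a::euclidean_space set" and c :: 'a
  assumes P: "polytope P" and x: "x extreme_point_of P" "c \<bullet> x < t"
    and x': "x' extreme_point_of P" "c \<bullet> x' < t"
  shows "(x, x') \<in> {(u, w). closed_segment u w \<in> edges P \<and> c \<bullet> u < t \<and> c \<bullet> w < t}\<^sup>*"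
    (is "_ \<in> ?R\<^sup>*")
proof -
  have "x \<in> P" using x by (simp add: extreme_point_of_def)
  then obtain p where p: "p \<in> P" "\<And>y. y \<in> P \<Longrightarrow> c \<bullet> p \<le> c \<bullet> y"
    "P \<inter> {x. c \<bullet> x = c \<bullet> p} face_of P"
    using minimum_attained_on_face[OF P, of c] by (metis empty_iff)
  define F where "F = P \<inter> {x. c \<bullet> x = c \<bullet> p}"
  have F: "F face_of P" "F \<noteq> {}" using p by (auto simp: F_def)
  have pF: "polytope F" using face_of_polytope_polytope[OF P F(1)] .
  obtain m where m: "m extreme_point_of F" using polytope_has_extreme_point pF F(2) .
  obtain d where d: "\<And>x. x \<in> F \<Longrightarrow> x \<noteq> m \<Longrightarrow> d \<bullet> x < d \<bullet> m"
    using extreme_point_exposing[OF pF m] by blast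
  have to_m: "(u, m) \<in> ?R\<^sup>*" if u: "u extreme_point_of P" "c \<bullet> u < t" for u
  proof -
    obtain y where y: "(u, y) \<in> (down_steps P c)\<^sup>*" "y extreme_point_of P" "\<forall>z\<in>P. c \<bullet> y \<le> c \<bullet> z"
      using descends_to_minimum[OF P u(1)] .
    have "(u, y) \<in> ?R\<^sup>* \<and> c \<bullet> y < t"
      using y(1)
    proof (induction rule: rtrancl_induct)
      case (step p q)
      then have pq: "closed_segment p q \<in> edges P" "c \<bullet> q < t" "c \<bullet> p < t"
        by (auto simp: down_steps_def)
      then have "(p, q) \<in> ?R" by simp
      then show ?case using step.IH pq(2) rtrancl.rtrancl_into_rtrancl[of u p ?R q] by blast
    qed (use u in simp)
    moreover have yF: "y \<in> F"
      using p y by (auto simp: F_def extreme_point_of_def intro: order_antisym)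
    then have "y extreme_point_of F" using y extreme_point_of_face[OF F(1)] by blast
    then obtain m' where m': "(y, m') \<in> (down_steps F (-d))\<^sup>*" "m' extreme_point_of F"
      "\<forall>z\<in>F. (-d) \<bullet> m' \<le> (-d) \<bullet> z"
      using descends_to_minimum[OF pF, where c = "-d"] by blast
    have mF: "m \<in> F" "m' \<in> F" using m m' by (auto simp: extreme_point_of_def)
    have "m' = m" using m'(3) mF d[of m'] by fastforce
    have "down_steps F (-d) \<subseteq> ?R"
    proof safe
      fix p q assume pq: "(p, q) \<in> down_steps F (-d)"
      then have e: "closed_segment p q \<in> edges P" "p \<in> F" "q \<in> F"
        using edges_of_face[OF F(1)] by (auto simp: down_steps_def)
      have "c \<bullet> p \<le> c \<bullet> y" "c \<bullet> q \<le> c \<bullet> y"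
        using e yF by (auto simp: F_def)
      then show "closed_segment p q \<in> edges P" "c \<bullet> p < t" "c \<bullet> q < t"
        using e calculation by auto
    qed
    then have "(y, m) \<in> ?R\<^sup>*" using m'(1) \<open>m' = m\<close> rtrancl_mono by blast
    ultimately show ?thesis by (meson rtrancl_trans)
  qed
  have "sym ?R" by (rule symI) (simp add: closed_segment_commute)
  then have "(m, x') \<in> ?R\<^sup>*" using symD[OF sym_rtrancl to_m[OF x']] by blast
  then show ?thesis using to_m[OF x] by (meson rtrancl_trans)
qed

section \<open>Edges and polygons at a vertex\<close>

lemma (in vertex_figure) slice_edge_unique:
  assumes "e \<in> star P v" "f \<in> star P v" "e \<inter> H = f \<inter> H"
  shows "e = f"
  using assms slice_mono[of e f] slice_mono[of f e] by (auto simp: star_def edges_def)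

definition lower_edge :: "'a::euclidean_space \<Rightarrow> 'a \<Rightarrow> 'a set \<Rightarrow> bool"
  where "lower_edge c v e \<longleftrightarrow> (\<exists>y\<in>e. c \<bullet> y < c \<bullet> v)"

lemma lower_edge_segment: "lower_edge c v (closed_segment v w) \<longleftrightarrow> c \<bullet> w < c \<bullet> v"
proof
  assume "lower_edge c v (closed_segment v w)"
  moreover have "closed_segment v w \<subseteq> {y. c \<bullet> y \<ge> c \<bullet> v}" if "\<not> c \<bullet> w < c \<bullet> v"
    using that by (intro closed_segment_subset) (auto simp: convex_halfspace_ge)
  ultimately show "c \<bullet> w < c \<bullet> v" by (fastforce simp: lower_edge_def)
qed (auto simp: lower_edge_def)

text \<open>This is \<open>graph_below_connected\<close> for the vertex figure at \<open>v\<close>.\<close>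

lemma lower_star_connected:
  fixes P :: "'a::euclidean_space set" and c :: 'a
  assumes P: "polytope P" and v: "v extreme_point_of P"
    and e: "e \<in> star P v" "lower_edge c v e" and f: "f \<in> star P v" "lower_edge c v f"
  shows "(e, f) \<in> {(e, f). e \<in> star P v \<and> f \<in> star P v \<and> lower_edge c v e \<and> lower_edge c v f \<and> e \<noteq> f \<and>
    (\<exists>G\<in>polygons P. e \<subseteq> G \<and> f \<subseteq> G)}\<^sup>*" (is "_ \<in> ?R\<^sup>*")
proof -
  obtain a \<beta> where "vertex_figure P v a \<beta>" using vertex_figure_exists P v by blast
  then interpret vf: vertex_figure P v a \<beta> .
  have slice: "\<exists>q. e \<inter> vf.H = {q} \<and> q extreme_point_of P \<inter> vf.H \<and> (c \<bullet> q < c \<bullet> v \<longleftrightarrow> lower_edge c v e)"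
    if "e \<in> star P v" for e
    using that vf.edge_slice[of e] unfolding star_def lower_edge_def by (metis (lifting) mem_Collect_eq)
  obtain q where q: "e \<inter> vf.H = {q}" "q extreme_point_of P \<inter> vf.H" "c \<bullet> q < c \<bullet> v"
    using slice e by blast
  obtain r where r: "f \<inter> vf.H = {r}" "r extreme_point_of P \<inter> vf.H" "c \<bullet> r < c \<bullet> v"
    using slice f by blast
  have "\<forall>f\<in>star P v. f \<inter> vf.H = {r} \<longrightarrow> (e, f) \<in> ?R\<^sup>*"
    using graph_below_connected[OF vf.polytope_slice q(2,3) r(2,3)]
  proof (induction rule: rtrancl_induct)
    case base
    have "e = f" if "f \<in> star P v" "f \<inter> vf.H = {q}" for f
      using vf.slice_edge_unique[OF e(1) that(1)] q(1) that(2) by simp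
    then show ?case by blast
  next
    case (step p s)
    show ?case
    proof (intro ballI impI)
      fix g assume g: "g \<in> star P v" "g \<inter> vf.H = {s}"
      have ps: "closed_segment p s \<in> edges (P \<inter> vf.H)" "c \<bullet> p < c \<bullet> v" "c \<bullet> s < c \<bullet> v"
        using step by auto
      note ps' = edge_segment_ends[OF ps(1)]
      obtain k where k: "k \<in> edges P" "v \<in> k" "k \<inter> vf.H = {p}" using vf.slice_vertex_edge[OF ps'(2)] .
      then have ks: "k \<in> star P v" by (simp add: star_def)
      obtain G where G: "G \<in> polygons P" "v \<in> G" "closed_segment p s = G \<inter> vf.H"
        using vf.slice_edge_polygon[OF ps(1)] .
      have "k \<subseteq> G" "g \<subseteq> G"
        using vf.slice_mono[of k G] vf.slice_mono[of g G] k g G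
        by (auto simp: star_def edges_def polygons_def)
      moreover have "k \<noteq> g" using k g ps' by auto
      moreover have "lower_edge c v k" "lower_edge c v g" using slice[OF ks] slice[OF g(1)] g(2) k(3) ps by auto
      ultimately have "(k, g) \<in> ?R" using ks g G by blast
      then show "(e, g) \<in> ?R\<^sup>*" using step.IH ks k by (meson rtrancl.rtrancl_into_rtrancl)
    qed
  qed
  then show ?thesis using f r by blast
qed

text \<open>This is \<open>descent\<close> for the vertex figure at \<open>v\<close>, starting from the vertex that represents \<open>e\<close>.\<close>

lemma star_descent:
  fixes P :: "'a::euclidean_space set" and c :: 'a
  assumes P: "polytope P" and v: "v extreme_point_of P"
    and e: "e \<in> star P v" "\<And>y. y \<in> e \<Longrightarrow> c \<bullet> y = c \<bullet> v" and z: "z \<in> P" "c \<bullet> z < c \<bullet> v"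
  obtains f G where "f \<in> star P v" "lower_edge c v f" "G \<in> polygons P" "e \<subseteq> G" "f \<subseteq> G"
proof -
  obtain a \<beta> where "vertex_figure P v a \<beta>" using vertex_figure_exists P v by blast
  then interpret vf: vertex_figure P v a \<beta> .
  have e': "e \<in> edges P" "v \<in> e" using e by (auto simp: star_def)
  obtain m where m: "m \<in> P \<inter> vf.H" "c \<bullet> m < c \<bullet> v" using vf.slice_has_lower_point[OF z] .
  obtain q where q: "e \<inter> vf.H = {q}" "q extreme_point_of P \<inter> vf.H"
    using vf.edge_slice[OF e'] by metis
  then have cq: "c \<bullet> q = c \<bullet> v" using e by blast
  have "c \<bullet> m < c \<bullet> q" using m(2) cq by simp
  then obtain r where "(q, r) \<in> down_steps (P \<inter> vf.H) c"
    using descent[OF vf.polytope_slice q(2) m(1)] by blast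
  then have r: "closed_segment q r \<in> edges (P \<inter> vf.H)" "c \<bullet> r < c \<bullet> v"
    using cq by (auto simp: down_steps_def)
  obtain G where G: "G \<in> polygons P" "v \<in> G" "closed_segment q r = G \<inter> vf.H"
    using vf.slice_edge_polygon[OF r(1)] .
  obtain f where f: "f \<in> edges P" "v \<in> f" "f \<inter> vf.H = {r}"
    using vf.slice_vertex_edge[OF edge_segment_ends(3)[OF r(1)]] .
  have "e \<subseteq> G" "f \<subseteq> G"
    using vf.slice_mono[of e G] vf.slice_mono[of f G] e' f q G
    by (auto simp: edges_def polygons_def)
  moreover have "lower_edge c v f" using f r by (auto simp: lower_edge_def)
  ultimately show ?thesis using that f G by (auto simp: star_def)
qed

text \<open>The vertex figure of a polygon is a segment, and a segment has two extreme points.\<close>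

lemma polygon_vertex_degree:
  fixes G :: "'a::euclidean_space set"
  assumes G: "polytope G" "aff_dim G = 2" and v: "v extreme_point_of G"
  shows "card (star G v) = 2"
proof -
  obtain a \<beta> where "vertex_figure G v a \<beta>" using vertex_figure_exists G v by blast
  then interpret vf: vertex_figure G v a \<beta> .
  have "aff_dim (G \<inter> vf.H) = 1"
    using vf.slice_dim[of G] G face_of_refl polytope_imp_convex vf.v_in by auto
  then obtain p q where pq: "p \<noteq> q" "G \<inter> vf.H = closed_segment p q"
    using polytope_dim1_segment[OF vf.polytope_slice] by blast
  obtain e where e: "e \<in> edges G" "v \<in> e" "e \<inter> vf.H = {p}"
    using vf.slice_vertex_edge[of p] pq by (auto simp: extreme_point_of_segment)
  obtain f where f: "f \<in> edges G" "v \<in> f" "f \<inter> vf.H = {q}"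
    using vf.slice_vertex_edge[of q] pq by (auto simp: extreme_point_of_segment)
  have "g = e \<or> g = f" if g: "g \<in> star G v" for g
  proof -
    obtain r where r: "g \<inter> vf.H = {r}" "r extreme_point_of G \<inter> vf.H"
      using vf.edge_slice[of g] g by (auto simp: star_def) metis
    then have "r = p \<or> r = q" using pq by (simp add: extreme_point_of_segment)
    moreover have "e \<in> star G v" "f \<in> star G v" using e f by (auto simp: star_def)
    ultimately show ?thesis using vf.slice_edge_unique[OF g] e(3) f(3) r(1) by metis
  qed
  then have "star G v = {e, f}" using e f by (auto simp: star_def)
  moreover have "e \<noteq> f" using e f pq by auto
  ultimately show ?thesis by simp
qed

section \<open>Cocycles modulo 2 are cuts\<close>

text \<open>The functionals that identify two given points form a hyperplane, and finitely many hyperplanes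
  do not cover the space.\<close>

lemma generic_functional:
  fixes V :: "'a::euclidean_space set"
  assumes "finite V"
  obtains c :: 'a where "inj_on ((\<bullet>) c) V"
proof -
  define N where "N = (\<Union>(u, w)\<in>{(u, w). u \<in> V \<and> w \<in> V \<and> u \<noteq> w}. {x. (u - w) \<bullet> x = 0})"
  have "finite {(u, w). u \<in> V \<and> w \<in> V \<and> u \<noteq> w}"
    by (rule finite_subset[of _ "V \<times> V"]) (use assms in auto)
  then have "negligible N"
    unfolding N_def by (intro negligible_Union) (auto intro: negligible_hyperplane)
  then have "N \<noteq> UNIV" by auto
  then obtain c where c: "c \<notin> N" by auto
  have "inj_on ((\<bullet>) c) V"
  proof (rule inj_onI)
    fix u w assume uw: "u \<in> V" "w \<in> V" "c \<bullet> u = c \<bullet> w"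
    then have "(u - w) \<bullet> c = 0" by (simp add: inner_commute[of "u - w"] inner_diff_right)
    then show "u = w" using c uw by (auto simp: N_def)
  qed
  then show ?thesis using that by blast
qed

lemma even_sum_cong:
  fixes m k :: "'b \<Rightarrow> nat"
  assumes "\<And>e. e \<in> R \<Longrightarrow> even (m e) = even (k e)"
  shows "even (sum m R) = even (sum k R)"
  using assms by (induction R rule: infinite_finite_induct) auto

text \<open>Double counting of the pairs \<open>(e, x)\<close> of an edge \<open>e\<close> and a vertex \<open>x \<noteq> v\<close> on it with \<open>x \<in> A\<close>. Every
  vertex is on two edges, so the number of pairs is even. An edge avoiding \<open>v\<close> contributes an odd
  number iff it is in \<open>S\<close>, and the two edges at \<open>v\<close> contribute \<open>1\<close> or \<open>0\<close> according to whether
  \<open>u \<in> A\<close> and \<open>w \<in> A\<close>. Comparison with the number of edges in \<open>S\<close>, which is even as well, leaves the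
  contributions of the edges at \<open>v\<close>.\<close>

lemma polygon_parity:
  fixes G :: "'a::euclidean_space set"
  assumes G: "polytope G" "aff_dim G = 2" and v: "v extreme_point_of G"
    and f: "closed_segment v u \<in> edges G" and g: "closed_segment v w \<in> edges G" and "u \<noteq> w"
    and S: "even (card {e \<in> edges G. e \<in> S})"
    and A: "\<And>x y. closed_segment x y \<in> edges G \<Longrightarrow> x \<noteq> v \<Longrightarrow> y \<noteq> v \<Longrightarrow>
      closed_segment x y \<in> S \<longleftrightarrow> (x \<in> A) \<noteq> (y \<in> A)"
  shows "((u \<in> A) \<noteq> (closed_segment v u \<in> S)) = ((w \<in> A) \<noteq> (closed_segment v w \<in> S))"
proof -
  let ?f = "closed_segment v u" and ?g = "closed_segment v w"
  \<comment> \<open>Without \<open>v\<close>, the two edges at \<open>v\<close> count their other ends only.\<close>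
  define B where "B = {x. x extreme_point_of G} \<inter> A - {v}"
  have finB: "finite B" unfolding B_def using finite_extreme_points[OF G(1)] by auto
  have finE: "finite (edges G)" by (rule finite_edges[OF G(1)])
  have vu: "v \<noteq> u" "u extreme_point_of G" using edge_segment_ends[OF f] by auto
  have vw: "v \<noteq> w" "w extreme_point_of G" using edge_segment_ends[OF g] by auto
  have fg: "?f \<noteq> ?g"
    using edge_extreme_points[OF g vu(2)] vu \<open>u \<noteq> w\<close> ends_in_segment(2)[of u v] by (auto simp: doubleton_eq_iff)
  have "card (star G v) = 2" by (rule polygon_vertex_degree[OF G v])
  moreover have "{?f, ?g} \<subseteq> star G v" using f g by (auto simp: star_def)
  ultimately have star: "star G v = {?f, ?g}"
    using fg card_seteq[of "star G v" "{?f, ?g}"] by (metis card_2_iff card.infinite le_refl zero_neq_numeral)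
  define R where "R = edges G - {?f, ?g}"
  have finR: "finite R" using finE by (simp add: R_def)
  have E: "edges G = insert ?f (insert ?g R)" using f g by (auto simp: R_def)
  have ends: "e \<inter> B = {x, y} \<inter> B" if "e \<in> edges G" "e = closed_segment x y" for e x y
    using that edge_extreme_points[of x y G] by (auto simp: B_def)
  have "(\<Sum>e\<in>edges G. card (e \<inter> B)) = (\<Sum>e\<in>edges G. \<Sum>x\<in>B. of_bool (x \<in> e))"
    using finB by (intro sum.cong) (auto simp: Int_commute)
  also have "\<dots> = (\<Sum>x\<in>B. \<Sum>e\<in>edges G. of_bool (x \<in> e))" by (rule sum.swap)
  also have "\<dots> = (\<Sum>x\<in>B. card (star G x))"
    using finE by (intro sum.cong) (auto simp: star_def Int_def)
  also have "\<dots> = (\<Sum>x\<in>B. 2)"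
    using polygon_vertex_degree[OF G] by (intro sum.cong) (auto simp: B_def)
  finally have ev1: "even (\<Sum>e\<in>edges G. card (e \<inter> B))" by simp
  have "card {e \<in> edges G. e \<in> S} = (\<Sum>e\<in>edges G. of_bool (e \<in> S))"
    using finE by (simp add: Int_def)
  then have ev2: "even (\<Sum>e\<in>edges G. of_bool (e \<in> S) :: nat)" using S by simp
  have "even (card (e \<inter> B)) = even (of_bool (e \<in> S) :: nat)" if e: "e \<in> R" for e
  proof -
    have eE: "e \<in> edges G" using e by (simp add: R_def)
    obtain x y where xy: "x \<noteq> y" "x extreme_point_of G" "y extreme_point_of G" "e = closed_segment x y"
      using edge_ends[OF G(1) eE] .
    have "v \<notin> e" using star e eE by (auto simp: R_def star_def)
    then have nv: "x \<noteq> v" "y \<noteq> v" using xy by auto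
    have "e \<in> S \<longleftrightarrow> (x \<in> A) \<noteq> (y \<in> A)" using A nv eE xy by blast
    moreover have "e \<inter> B = (if x \<in> A then {x} else {}) \<union> (if y \<in> A then {y} else {})"
      using ends[OF eE xy(4)] xy nv by (auto simp: B_def)
    ultimately show ?thesis using xy by auto
  qed
  then have evR: "even (\<Sum>e\<in>R. card (e \<inter> B)) = even (\<Sum>e\<in>R. of_bool (e \<in> S) :: nat)"
    by (rule even_sum_cong)
  have "?f \<inter> B = (if u \<in> A then {u} else {})" using ends[OF f refl] vu by (auto simp: B_def)
  then have cf: "card (?f \<inter> B) = of_bool (u \<in> A)" by simp
  have "?g \<inter> B = (if w \<in> A then {w} else {})" using ends[OF g refl] vw by (auto simp: B_def)
  then have cg: "card (?g \<inter> B) = of_bool (w \<in> A)" by simp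
  have s1: "sum m (edges G) = m ?f + (m ?g + sum m R)" for m :: "'a set \<Rightarrow> nat"
    by (subst E) (use finR fg in \<open>simp add: R_def\<close>)
  show ?thesis using ev1 ev2 evR unfolding s1 cf cg by auto
qed

text \<open>The first cohomology modulo 2 of the 2-skeleton of a polytope vanishes: a set of edges that meets
  every polygon evenly consists of the edges between a set \<open>A\<close> of vertices and its complement.
  The vertices are assigned to \<open>A\<close> or its complement in increasing order with respect to a generic
  linear functional \<open>c\<close>. Each edge that descends from a new vertex \<open>v\<close> dictates on which side \<open>v\<close> has
  to be. Two such edges in a common polygon \<open>G\<close> dictate the same, by \<open>polygon_parity\<close>: \<open>v\<close> is the top
  vertex of \<open>G\<close>, so that all other vertices of \<open>G\<close> have been assigned before. As the descending edges
  are connected via polygons by \<open>lower_star_connected\<close>, all of them agree.\<close>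

theorem even_edge_set_is_cut:
  fixes P :: "'a::euclidean_space set"
  assumes P: "polytope P" and even: "\<And>G. G \<in> polygons P \<Longrightarrow> even (card {e \<in> S. e \<subseteq> G})"
    and "S \<subseteq> edges P"
  obtains A where "\<And>u w. closed_segment u w \<in> edges P \<Longrightarrow>
    closed_segment u w \<in> S \<longleftrightarrow> (u \<in> A) \<noteq> (w \<in> A)"
proof -
  define V where "V = {x. x extreme_point_of P}"
  have finV: "finite V" using finite_extreme_points[OF P] by (simp add: V_def)
  obtain c where inj: "inj_on ((\<bullet>) c) V" using generic_functional[OF finV] .
  have "\<exists>A\<subseteq>U. \<forall>u\<in>U. \<forall>w\<in>U. closed_segment u w \<in> edges P \<longrightarrow>
      (closed_segment u w \<in> S \<longleftrightarrow> (u \<in> A) \<noteq> (w \<in> A))"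
    if "U \<subseteq> V" "\<And>u w. u \<in> U \<Longrightarrow> w \<in> V \<Longrightarrow> c \<bullet> w < c \<bullet> u \<Longrightarrow> w \<in> U" for U
    using that
  proof (induction "card U" arbitrary: U)
    case 0
    then have "U = {}" using finite_subset[OF 0(2) finV] by simp
    then show ?case by blast
  next
    case (Suc n)
    have finU: "finite U" using Suc.prems finV finite_subset by blast
    have "U \<noteq> {}" using Suc.hyps(2) by auto
    define m where "m = Max ((\<bullet>) c ` U)"
    have "m \<in> (\<bullet>) c ` U" unfolding m_def using finU \<open>U \<noteq> {}\<close> by (intro Max_in) auto
    then obtain v where v: "v \<in> U" "m = c \<bullet> v" by blast
    have top: "c \<bullet> u < c \<bullet> v" if "u \<in> U" "u \<noteq> v" for u
    proof -
      have "c \<bullet> u \<le> c \<bullet> v" unfolding v(2)[symmetric] m_def using finU that by (intro Max_ge) auto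
      moreover have "c \<bullet> u \<noteq> c \<bullet> v" using inj that v Suc.prems(1) by (auto simp: inj_on_def)
      ultimately show ?thesis by simp
    qed
    have vP: "v extreme_point_of P" using v Suc.prems(1) by (auto simp: V_def)
    define U' where "U' = U - {v}"
    have lowU': "w \<in> U'" if "w \<in> V" "c \<bullet> w < c \<bullet> v" for w
      using Suc.prems(2)[OF v(1) that] that by (auto simp: U'_def)
    have "n = card U'" using Suc.hyps(2) v finU by (simp add: U'_def)
    moreover have "U' \<subseteq> V" using Suc.prems(1) by (auto simp: U'_def)
    moreover have "w \<in> U'" if "u \<in> U'" "w \<in> V" "c \<bullet> w < c \<bullet> u" for u w
    proof (rule lowU'[OF that(2)])
      have "c \<bullet> u < c \<bullet> v" using top that(1) by (auto simp: U'_def)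
      then show "c \<bullet> w < c \<bullet> v" using that by simp
    qed
    ultimately have "\<exists>A\<subseteq>U'. \<forall>u\<in>U'. \<forall>w\<in>U'. closed_segment u w \<in> edges P \<longrightarrow>
      (closed_segment u w \<in> S \<longleftrightarrow> (u \<in> A) \<noteq> (w \<in> A))"
      by (rule Suc.hyps(1))
    then obtain A where A: "A \<subseteq> U'" "\<And>u w. u \<in> U' \<Longrightarrow> w \<in> U' \<Longrightarrow> closed_segment u w \<in> edges P \<Longrightarrow>
      closed_segment u w \<in> S \<longleftrightarrow> (u \<in> A) \<noteq> (w \<in> A)"
      by blast
    \<comment> \<open>\<open>h e\<close> tells whether the edge \<open>e\<close>, descending from \<open>v\<close>, requires \<open>v\<close> to be in \<open>A\<close>.\<close>
    define h where "h e \<longleftrightarrow> ((\<exists>u. e = closed_segment v u \<and> u \<in> A) \<noteq> (e \<in> S))" for e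
    have h_seg: "h (closed_segment v u) \<longleftrightarrow> ((u \<in> A) \<noteq> (closed_segment v u \<in> S))"
      if e: "closed_segment v u \<in> edges P" for u
    proof -
      have "u' = u" if "closed_segment v u = closed_segment v u'" for u'
        using that edge_segment_ends(1)[OF e] by (auto simp: doubleton_eq_iff)
      then show ?thesis by (auto simp: h_def)
    qed
    have h_polygon: "h e = h f"
      if e: "e \<in> star P v" "lower_edge c v e" and f: "f \<in> star P v" "lower_edge c v f"
        and "e \<noteq> f" and G: "G \<in> polygons P" "e \<subseteq> G" "f \<subseteq> G" for e f G
    proof -
      have GP: "G face_of P" "aff_dim G = 2" using G by (auto simp: polygons_def)
      have pG: "polytope G" by (rule face_of_polytope_polytope[OF P GP(1)])
      obtain u where u: "u \<noteq> v" "u extreme_point_of P" "e = closed_segment v u"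
        using edge_other_end[OF P _ vP, of e] e by (auto simp: star_def)
      obtain w where w: "w \<noteq> v" "w extreme_point_of P" "f = closed_segment v w"
        using edge_other_end[OF P _ vP, of f] f by (auto simp: star_def)
      have cuw: "c \<bullet> u < c \<bullet> v" "c \<bullet> w < c \<bullet> v"
        using e f u w by (auto simp: lower_edge_segment)
      have EG: "edges G = {e \<in> edges P. e \<subseteq> G}" by (rule edges_of_face[OF GP(1)])
      have eG: "closed_segment v u \<in> edges G" "closed_segment v w \<in> edges G"
        using EG e f u w G by (auto simp: star_def)
      have vG: "v extreme_point_of G" using edge_segment_ends[OF eG(1)] by blast
      have uw: "u \<noteq> w" using \<open>e \<noteq> f\<close> u w by auto
      have ne: "closed_segment v u \<noteq> closed_segment v w" using \<open>e \<noteq> f\<close> u w by auto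
      have sub: "{closed_segment v u, closed_segment v w} \<subseteq> star G v" using eG by (auto simp: star_def)
      have card2: "card (star G v) = 2" by (rule polygon_vertex_degree[OF pG GP(2) vG])
      then have "finite (star G v)" using card.infinite by fastforce
      then have star: "{closed_segment v u, closed_segment v w} = star G v"
        by (rule card_subset_eq[OF _ sub]) (use ne card2 in simp)
      \<comment> \<open>Otherwise \<open>v\<close> would have an ascending edge in \<open>G\<close>, but its only edges are descending.\<close>
      have vtop: "c \<bullet> z \<le> c \<bullet> v" if z: "z \<in> G" for z
      proof (rule ccontr)
        assume "\<not> ?thesis"
        then have "(-c) \<bullet> z < (-c) \<bullet> v" by simp
        then obtain y where "(v, y) \<in> down_steps G (-c)" using descent[OF pG vG z] by blast
        then have y: "closed_segment v y \<in> edges G" "c \<bullet> v < c \<bullet> y" by (auto simp: down_steps_def)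
        then have "closed_segment v y \<in> star G v" by (simp add: star_def)
        then have "closed_segment v y = closed_segment v u \<or> closed_segment v y = closed_segment v w"
          using star by blast
        then have "lower_edge c v (closed_segment v y)" using cuw by (auto simp: lower_edge_segment)
        then show False using y by (simp add: lower_edge_segment)
      qed
      have inU': "x \<in> U'" if x: "x extreme_point_of G" "x \<noteq> v" for x
      proof (rule lowU')
        show xV: "x \<in> V" using x extreme_point_of_face[OF GP(1)] by (simp add: V_def)
        have "c \<bullet> x \<noteq> c \<bullet> v" using inj xV vP x(2) by (auto simp: inj_on_def V_def)
        moreover have "c \<bullet> x \<le> c \<bullet> v" using vtop x(1) by (simp add: extreme_point_of_def)
        ultimately show "c \<bullet> x < c \<bullet> v" by simp
      qed
      have "{e \<in> edges G. e \<in> S} = {e \<in> S. e \<subseteq> G}" using EG \<open>S \<subseteq> edges P\<close> by blast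
      then have evG: "even (card {e \<in> edges G. e \<in> S})" using even[OF G(1)] by simp
      have AG: "closed_segment x y \<in> S \<longleftrightarrow> (x \<in> A) \<noteq> (y \<in> A)"
        if "closed_segment x y \<in> edges G" "x \<noteq> v" "y \<noteq> v" for x y
      proof (rule A(2))
        show "x \<in> U'" "y \<in> U'" using inU' edge_segment_ends[OF that(1)] that by auto
        show "closed_segment x y \<in> edges P" using that EG by auto
      qed
      have "((u \<in> A) \<noteq> (closed_segment v u \<in> S)) = ((w \<in> A) \<noteq> (closed_segment v w \<in> S))"
        by (rule polygon_parity[OF pG GP(2) vG eG uw evG AG])
      then show ?thesis using h_seg eG EG u w by simp
    qed
    have h_const: "h e = h f"
      if e: "e \<in> star P v" "lower_edge c v e" and f: "f \<in> star P v" "lower_edge c v f" for e f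
      using lower_star_connected[OF P vP e f]
    proof (induction rule: rtrancl_induct)
      case (step p q)
      then obtain G where "p \<in> star P v" "q \<in> star P v" "lower_edge c v p" "lower_edge c v q" "p \<noteq> q"
        "G \<in> polygons P" "p \<subseteq> G" "q \<subseteq> G" by blast
      then have "h p = h q" using h_polygon by blast
      then show ?case using step.IH by simp
    qed simp
    define A' where "A' = (if \<exists>e\<in>star P v. lower_edge c v e \<and> h e then insert v A else A)"
    have vA': "v \<in> A' \<longleftrightarrow> h e" if "e \<in> star P v" "lower_edge c v e" for e
    proof -
      have "v \<notin> A" using A(1) by (auto simp: U'_def)
      moreover have "(\<exists>f\<in>star P v. lower_edge c v f \<and> h f) \<longleftrightarrow> h e"
        using that h_const by blast
      ultimately show ?thesis by (simp add: A'_def)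
    qed
    have uA': "u \<in> A' \<longleftrightarrow> u \<in> A" if "u \<noteq> v" for u using that by (simp add: A'_def)
    have edge_v: "closed_segment v u \<in> S \<longleftrightarrow> (v \<in> A') \<noteq> (u \<in> A')"
      if "u \<in> U" and e: "closed_segment v u \<in> edges P" for u
    proof -
      have "u \<noteq> v" using edge_segment_ends[OF e] by auto
      then have "lower_edge c v (closed_segment v u)" using top that by (simp add: lower_edge_segment)
      moreover have "closed_segment v u \<in> star P v" using e by (simp add: star_def)
      ultimately have "v \<in> A' \<longleftrightarrow> h (closed_segment v u)" by (rule vA'[rotated])
      then show ?thesis using h_seg[OF e] uA'[OF \<open>u \<noteq> v\<close>] by blast
    qed
    have "closed_segment u w \<in> S \<longleftrightarrow> (u \<in> A') \<noteq> (w \<in> A')"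
      if "u \<in> U" "w \<in> U" and e: "closed_segment u w \<in> edges P" for u w
    proof -
      consider "u = v" | "w = v" | "u \<noteq> v" "w \<noteq> v" by blast
      then show ?thesis
      proof cases
        case 1 then show ?thesis using edge_v that by blast
      next
        case 2
        have vu: "closed_segment u v = closed_segment v u" by (rule closed_segment_commute)
        have "closed_segment v u \<in> edges P" using e unfolding 2 vu .
        from edge_v[OF that(1) this] show ?thesis unfolding 2 vu by blast
      next
        case 3 then show ?thesis using A(2)[of u w] that uA' by (simp add: U'_def)
      qed
    qed
    moreover have "A' \<subseteq> U" using A(1) v by (auto simp: A'_def U'_def)
    ultimately show ?case by blast
  qed
  from this[of V] obtain A where A: "\<forall>u\<in>V. \<forall>w\<in>V. closed_segment u w \<in> edges P \<longrightarrow>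
      (closed_segment u w \<in> S \<longleftrightarrow> (u \<in> A) \<noteq> (w \<in> A))"
    by blast
  show ?thesis
  proof (rule that)
    fix u w assume e: "closed_segment u w \<in> edges P"
    have "u \<in> V" "w \<in> V" using edge_segment_ends[OF e] by (auto simp: V_def)
    then show "closed_segment u w \<in> S \<longleftrightarrow> (u \<in> A) \<noteq> (w \<in> A)" using A e by blast
  qed
qed

section \<open>The edges avoiding a vertex are connected\<close>

lemma aff_dim_ge_1:
  fixes J :: "'a::euclidean_space set"
  assumes "x \<in> J" "y \<in> J" "x \<noteq> y"
  shows "aff_dim J \<ge> 1"
  using aff_dim_subset[of "{x, y}" J] assms by (simp add: aff_dim_2)

definition linked :: "'a set set \<Rightarrow> 'a set set \<Rightarrow> ('a set \<times> 'a set) set"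
  where "linked S R = {(e, f). e \<in> S \<and> f \<in> S \<and> (\<exists>G\<in>R. e \<subseteq> G \<and> f \<subseteq> G)}"

lemma star_of_face:
  assumes "G face_of P"
  shows "star G v = {e \<in> star P v. e \<subseteq> G}"
  using edges_of_face[OF assms] by (auto simp: star_def)

lemma face_proper_dim:
  fixes J :: "'a::euclidean_space set"
  assumes "polytope P" "J face_of P" "G face_of P" "J \<subseteq> G" "J \<noteq> G"
  shows "aff_dim J < aff_dim G"
proof (rule face_of_aff_dim_lt)
  show "convex G" using assms(3) by (rule face_of_imp_convex)
  show "J face_of G" using assms by (simp add: face_of_face)
qed (rule assms(5))

text \<open>Let \<open>J\<close> be the smallest face that contains \<open>x\<close> and \<open>v\<close>; every polygon through \<open>x\<close> and \<open>v\<close> contains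
  \<open>J\<close>. If \<open>J = P\<close>, there are no such polygons by dimension, and it is enough that the edges at \<open>x\<close> are
  connected via polygons. Otherwise let \<open>c\<close> be a functional that attains its maximum over \<open>P\<close> exactly
  on \<open>J\<close>. The edges at \<open>x\<close> that leave \<open>J\<close> are those descending for \<open>c\<close>, and they are connected via
  polygons with two descending edges at \<open>x\<close>. Such a polygon through \<open>v\<close> would contain \<open>J\<close> properly,
  so \<open>J\<close> would be a third edge of it at \<open>x\<close>. An edge at \<open>x\<close> inside \<open>J\<close> is linked to a descending one by
  a polygon that leaves \<open>J\<close>; again this polygon cannot contain \<open>v\<close>, since \<open>J\<close> would then be an edge and
  hence the given edge, which avoids \<open>v\<close>.\<close>

lemma antistar_connected_at_vertex:
  fixes P :: "'a::euclidean_space set"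
  assumes P: "polytope P" "aff_dim P \<ge> 3" and v: "v \<in> P"
    and x: "x extreme_point_of P" "x \<noteq> v"
    and e: "e \<in> star P x" "v \<notin> e" and f: "f \<in> star P x" "v \<notin> f"
  shows "(e, f) \<in> (linked (edges P - star P v) {G \<in> polygons P. v \<notin> G})\<^sup>*" (is "_ \<in> ?R\<^sup>*")
proof -
  have xP: "x \<in> P" using x by (simp add: extreme_point_of_def)
  define J where "J = \<Inter>{F. F face_of P \<and> x \<in> F \<and> v \<in> F}"
  have JP: "J face_of P"
    unfolding J_def using v xP face_of_refl[OF polytope_imp_convex[OF P(1)]]
    by (intro face_of_Inter) auto
  have Jmin: "J \<subseteq> F" if "F face_of P" "x \<in> F" "v \<in> F" for F using that by (auto simp: J_def)
  have J: "x \<in> J" "v \<in> J" by (auto simp: J_def)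
  have J1: "aff_dim J \<ge> 1" using aff_dim_ge_1[OF J x(2)] .
  show ?thesis
  proof (cases "J = P")
    case True
    obtain c where c: "\<And>y. y \<in> P \<Longrightarrow> y \<noteq> x \<Longrightarrow> c \<bullet> y < c \<bullet> x"
      using extreme_point_exposing[OF P(1) x(1)] by blast
    have low: "lower_edge c x g" if g: "g \<in> star P x" for g
    proof -
      obtain w where "w \<noteq> x" "w extreme_point_of P" "g = closed_segment x w"
        using edge_other_end[OF P(1) _ x(1), of g] g by (auto simp: star_def)
      then show ?thesis using c by (auto simp: lower_edge_segment extreme_point_of_def)
    qed
    have "v \<notin> G" if "G \<in> polygons P" "x \<in> G" for G
      using Jmin[of G] that P(2) aff_dim_subset[of P G] True by (auto simp: polygons_def)
    then have "{(e, f). e \<in> star P x \<and> f \<in> star P x \<and> lower_edge c x e \<and> lower_edge c x f \<and> e \<noteq> f \<and>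
        (\<exists>G\<in>polygons P. e \<subseteq> G \<and> f \<subseteq> G)} \<subseteq> ?R"
      unfolding linked_def star_def by blast
    then show ?thesis
      using lower_star_connected[OF P(1) x(1) e(1) low[OF e(1)] f(1) low[OF f(1)]] rtrancl_mono
      by blast
  next
    case False
    obtain c b where c: "P \<subseteq> {y. c \<bullet> y \<le> b}" "J = P \<inter> {y. c \<bullet> y = b}"
      using face_of_polytope_exposed[OF P(1) JP] .
    have cx: "c \<bullet> x = b" using c J by auto
    obtain z where z: "z \<in> P" "c \<bullet> z < c \<bullet> x"
      using False c face_of_imp_subset[OF JP] cx by fastforce
    have notJ: "\<not> g \<subseteq> J" if "lower_edge c x g" for g
      using that c cx by (auto simp: lower_edge_def)
    have lower_v: "v \<notin> G" if G: "G \<in> polygons P" and p: "p \<in> star P x" "lower_edge c x p" "p \<subseteq> G"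
      and q: "q \<in> star P x" "lower_edge c x q" "q \<subseteq> G" and "p \<noteq> q" for p q G
    proof
      assume "v \<in> G"
      have GP: "G face_of P" "aff_dim G = 2" using G by (auto simp: polygons_def)
      have pG: "polytope G" by (rule face_of_polytope_polytope[OF P(1) GP(1)])
      have xG: "x \<in> G" using p by (auto simp: star_def)
      have "J \<subseteq> G" using Jmin[OF GP(1) xG \<open>v \<in> G\<close>] .
      moreover have "J \<noteq> G" using notJ[OF p(2)] p(3) by blast
      ultimately have "aff_dim J < 2" using face_proper_dim[OF P(1) JP GP(1)] GP by simp
      then have "aff_dim J = 1" using J1 by simp
      then have "J \<in> star G x" using JP J \<open>J \<subseteq> G\<close> GP by (auto simp: star_def edges_def face_of_face)
      moreover have "p \<in> star G x" "q \<in> star G x" using p q by (auto simp: star_of_face[OF GP(1)])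
      ultimately have sub: "{J, p, q} \<subseteq> star G x" by blast
      have "J \<noteq> p" "J \<noteq> q" using notJ[OF p(2)] notJ[OF q(2)] by blast+
      then have "card {J, p, q} = 3" using \<open>p \<noteq> q\<close> by simp
      moreover have "x extreme_point_of G" using extreme_point_of_face[OF GP(1)] x xG by blast
      then have "card (star G x) = 2" by (rule polygon_vertex_degree[OF pG GP(2)])
      moreover have "finite (star G x)" using finite_edges[OF pG] by (simp add: star_def)
      ultimately show False using card_mono[OF _ sub] by simp
    qed
    have "{(e, f). e \<in> star P x \<and> f \<in> star P x \<and> lower_edge c x e \<and> lower_edge c x f \<and> e \<noteq> f \<and>
        (\<exists>G\<in>polygons P. e \<subseteq> G \<and> f \<subseteq> G)} \<subseteq> ?R"
    proof (rule subrelI)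
      fix p q assume "(p, q) \<in> {(e, f). e \<in> star P x \<and> f \<in> star P x \<and> lower_edge c x e \<and> lower_edge c x f \<and>
        e \<noteq> f \<and> (\<exists>G\<in>polygons P. e \<subseteq> G \<and> f \<subseteq> G)}"
      then obtain G where pq: "p \<in> star P x" "q \<in> star P x" "lower_edge c x p" "lower_edge c x q" "p \<noteq> q"
        and G: "G \<in> polygons P" "p \<subseteq> G" "q \<subseteq> G" by blast
      have "v \<notin> G" using lower_v[OF G(1) pq(1,3) G(2) pq(2,4) G(3) pq(5)] .
      then show "(p, q) \<in> ?R" using pq G by (auto simp: linked_def star_def)
    qed
    then have low_R: "(p, q) \<in> ?R\<^sup>*" if "p \<in> star P x" "lower_edge c x p" "q \<in> star P x" "lower_edge c x q" for p q
      using lower_star_connected[OF P(1) x(1) that] rtrancl_mono by blast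
    have to_low: "\<exists>h. h \<in> star P x \<and> lower_edge c x h \<and> (g, h) \<in> ?R\<^sup>* \<and> (h, g) \<in> ?R\<^sup>*"
      if g: "g \<in> star P x" "v \<notin> g" for g
    proof (cases "lower_edge c x g")
      case True then show ?thesis using g by blast
    next
      case False
      have gP: "g face_of P" "aff_dim g = 1" "x \<in> g" using g by (auto simp: star_def edges_def)
      have flat: "c \<bullet> y = c \<bullet> x" if "y \<in> g" for y
        using False c cx that face_of_imp_subset[OF gP(1)]
        by (force simp: lower_edge_def intro: order_antisym)
      obtain h G where h: "h \<in> star P x" "lower_edge c x h" and G: "G \<in> polygons P" "g \<subseteq> G" "h \<subseteq> G"
        using star_descent[OF P(1) x(1) g(1) flat z] .
      have "v \<notin> G"
      proof
        assume "v \<in> G"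
        have GP: "G face_of P" "aff_dim G = 2" using G by (auto simp: polygons_def)
        have "J \<subseteq> G" using Jmin[OF GP(1)] \<open>v \<in> G\<close> G gP by blast
        moreover have "J \<noteq> G" using notJ[OF h(2)] G by blast
        ultimately have "aff_dim J < 2" using face_proper_dim[OF P(1) JP GP(1)] GP by simp
        moreover have "g \<subseteq> J" using flat cx c face_of_imp_subset[OF gP(1)] by blast
        moreover have "g \<noteq> J" using g J by blast
        ultimately show False using face_proper_dim[OF P(1) gP(1) JP] gP by simp
      qed
      then have "(g, h) \<in> ?R" "(h, g) \<in> ?R" using g h G by (auto simp: linked_def star_def)
      then show ?thesis using h by blast
    qed
    obtain h k where "h \<in> star P x" "lower_edge c x h" "(e, h) \<in> ?R\<^sup>*"
      "k \<in> star P x" "lower_edge c x k" "(k, f) \<in> ?R\<^sup>*"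
      using to_low[OF e] to_low[OF f] by blast
    then show ?thesis using low_R[of h k] by (meson rtrancl_trans)
  qed
qed

text \<open>The graph of \<open>P\<close> without \<open>v\<close> is connected, because it is the part of the graph below the level of \<open>v\<close>
  for a functional with its unique maximum in \<open>v\<close>. A path in it is turned into a chain of polygons by
  linking consecutive edges at their common vertex with \<open>antistar_connected_at_vertex\<close>.\<close>

lemma antistar_connected:
  fixes P :: "'a::euclidean_space set"
  assumes P: "polytope P" "aff_dim P \<ge> 3" and v: "v extreme_point_of P"
    and e: "e \<in> edges P - star P v" and f: "f \<in> edges P - star P v"
  shows "(e, f) \<in> (linked (edges P - star P v) {G \<in> polygons P. v \<notin> G})\<^sup>*" (is "_ \<in> ?R\<^sup>*")
proof -
  have vP: "v \<in> P" using v by (simp add: extreme_point_of_def)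
  obtain c where c: "\<And>y. y \<in> P \<Longrightarrow> y \<noteq> v \<Longrightarrow> c \<bullet> y < c \<bullet> v"
    using extreme_point_exposing[OF P(1) v] by blast
  have ext: "y \<in> P" if "y extreme_point_of P" for y using that by (simp add: extreme_point_of_def)
  obtain x x' where x: "x extreme_point_of P" "e = closed_segment x x'"
    using edge_ends[OF P(1), of e] e by (metis DiffD1)
  obtain y y' where y: "y extreme_point_of P" "f = closed_segment y y'"
    using edge_ends[OF P(1), of f] f by (metis DiffD1)
  have ve: "v \<notin> e" "v \<notin> f" using e f by (auto simp: star_def)
  then have xy: "x \<noteq> v" "y \<noteq> v" using x y by auto
  have es: "e \<in> star P x" "f \<in> star P y" using e f x y by (auto simp: star_def)
  have "\<forall>f. f \<in> star P y \<and> v \<notin> f \<longrightarrow> (e, f) \<in> ?R\<^sup>*"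
    using graph_below_connected[OF P(1) x(1) c[OF ext[OF x(1)] xy(1)] y(1) c[OF ext[OF y(1)] xy(2)]]
  proof (induction rule: rtrancl_induct)
    case base
    then show ?case using antistar_connected_at_vertex[OF P vP x(1) xy(1) es(1) ve(1)] by blast
  next
    case (step p q)
    show ?case
    proof (intro allI impI)
      fix g assume g: "g \<in> star P q \<and> v \<notin> g"
      have pq: "closed_segment p q \<in> edges P" "c \<bullet> p < c \<bullet> v" "c \<bullet> q < c \<bullet> v"
        using step.hyps(2) by auto
      have "closed_segment p q \<subseteq> {y. c \<bullet> y < c \<bullet> v}"
        using pq by (intro closed_segment_subset) (auto simp: convex_halfspace_lt)
      then have nv: "v \<notin> closed_segment p q" by auto
      have "closed_segment p q \<in> star P p" "closed_segment p q \<in> star P q"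
        using pq by (auto simp: star_def)
      then have "(e, closed_segment p q) \<in> ?R\<^sup>*" using step.IH nv by blast
      moreover have "(closed_segment p q, g) \<in> ?R\<^sup>*"
      proof (rule antistar_connected_at_vertex[OF P vP edge_segment_ends(3)[OF pq(1)]])
        show "q \<noteq> v" using pq by auto
        show "closed_segment p q \<in> star P q" using pq by (auto simp: star_def)
      qed (use g nv in auto)
      ultimately show "(e, g) \<in> ?R\<^sup>*" by (meson rtrancl_trans)
    qed
  qed
  then show ?thesis using es ve by blast
qed

section \<open>A combinatorial description of vertex stars\<close>

text \<open>The conditions say that \<open>S\<close> looks like a small sphere around a vertex: it meets each polygon
  in no edge or in two edges, it is connected, and what remains outside of it is connected. The last condition separates the star of a vertex from the edges crossing a general
  hyperplane, which satisfy the others.\<close>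

definition star_like :: "'a set set \<Rightarrow> 'a set set \<Rightarrow> 'a set set \<Rightarrow> bool"
  where "star_like E R S \<longleftrightarrow> S \<subseteq> E \<and> S \<noteq> {} \<and> (\<forall>G\<in>R. card {e \<in> S. e \<subseteq> G} \<in> {0, 2}) \<and>
    (\<forall>e\<in>S. \<forall>f\<in>S. (e, f) \<in> (linked S R)\<^sup>*) \<and>
    (\<forall>e\<in>E - S. \<forall>f\<in>E - S. (e, f) \<in> (linked (E - S) {G \<in> R. \<forall>e\<in>S. \<not> e \<subseteq> G})\<^sup>*)"

lemma linked_image:
  assumes "(e, f) \<in> (linked S R)\<^sup>*" and "\<And>e G. e \<in> S \<Longrightarrow> G \<in> R \<Longrightarrow> e \<subseteq> G \<Longrightarrow> \<phi> e \<subseteq> \<phi> G"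
  shows "(\<phi> e, \<phi> f) \<in> (linked (\<phi> ` S) (\<phi> ` R))\<^sup>*"
  using assms(1)
proof (induction rule: rtrancl_induct)
  case (step p q)
  then obtain G where G: "p \<in> S" "q \<in> S" "G \<in> R" "p \<subseteq> G" "q \<subseteq> G" by (auto simp: linked_def)
  then have "\<phi> p \<subseteq> \<phi> G" "\<phi> q \<subseteq> \<phi> G" using assms(2) by blast+
  then have "(\<phi> p, \<phi> q) \<in> linked (\<phi> ` S) (\<phi> ` R)"
    unfolding linked_def using G(1-3) by blast
  then show ?case using step.IH by simp
qed simp

lemma star_like_image:
  assumes inj: "inj_on \<phi> E" and inc: "\<And>e G. e \<in> E \<Longrightarrow> G \<in> R \<Longrightarrow> \<phi> e \<subseteq> \<phi> G \<longleftrightarrow> e \<subseteq> G"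
    and S: "star_like E R S"
  shows "star_like (\<phi> ` E) (\<phi> ` R) (\<phi> ` S)"
proof -
  have SE: "S \<subseteq> E" "S \<noteq> {}" using S by (auto simp: star_like_def)
  have diff: "\<phi> ` E - \<phi> ` S = \<phi> ` (E - S)" using inj_on_image_set_diff[OF inj, of E S] SE by simp
  have untouched: "{G \<in> \<phi> ` R. \<forall>e\<in>\<phi> ` S. \<not> e \<subseteq> G} = \<phi> ` {G \<in> R. \<forall>e\<in>S. \<not> e \<subseteq> G}"
  proof -
    have "(\<forall>e\<in>\<phi> ` S. \<not> e \<subseteq> \<phi> G) \<longleftrightarrow> (\<forall>e\<in>S. \<not> e \<subseteq> G)" if "G \<in> R" for G
      using inc[OF subsetD[OF SE(1)] that] by simp
    then show ?thesis by auto
  qed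
  have card02: "card {e \<in> \<phi> ` S. e \<subseteq> \<phi> G} \<in> {0, 2}" if G: "G \<in> R" for G
  proof -
    have "{e \<in> \<phi> ` S. e \<subseteq> \<phi> G} = \<phi> ` {e \<in> S. e \<subseteq> G}"
      using inc[OF subsetD[OF SE(1)] G] by auto
    moreover have "inj_on \<phi> {e \<in> S. e \<subseteq> G}" using inj SE by (auto simp: inj_on_def)
    ultimately have "card {e \<in> \<phi> ` S. e \<subseteq> \<phi> G} = card {e \<in> S. e \<subseteq> G}" by (simp add: card_image)
    then show ?thesis using S G by (auto simp: star_like_def)
  qed
  have con: "(\<phi> e, \<phi> f) \<in> (linked (\<phi> ` S) (\<phi> ` R))\<^sup>*" if "e \<in> S" "f \<in> S" for e f
    by (rule linked_image) (use S inc SE that in \<open>auto simp: star_like_def\<close>)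
  have con': "(\<phi> e, \<phi> f) \<in> (linked (\<phi> ` (E - S)) (\<phi> ` {G \<in> R. \<forall>e\<in>S. \<not> e \<subseteq> G}))\<^sup>*"
    if "e \<in> E - S" "f \<in> E - S" for e f
    by (rule linked_image) (use S inc SE that in \<open>auto simp: star_like_def\<close>)
  show ?thesis
    unfolding star_like_def diff untouched
  proof (intro conjI ballI)
    show "\<phi> ` S \<subseteq> \<phi> ` E" "\<phi> ` S \<noteq> {}" using SE by auto
  next
    fix G assume "G \<in> \<phi> ` R"
    then show "card {e \<in> \<phi> ` S. e \<subseteq> G} \<in> {0, 2}" using card02 by (elim imageE) simp
  next
    fix e f assume "e \<in> \<phi> ` S" "f \<in> \<phi> ` S"
    then show "(e, f) \<in> (linked (\<phi> ` S) (\<phi> ` R))\<^sup>*" using con by (elim imageE) simp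
  next
    fix e f assume "e \<in> \<phi> ` (E - S)" "f \<in> \<phi> ` (E - S)"
    then show "(e, f) \<in> (linked (\<phi> ` (E - S)) (\<phi> ` {G \<in> R. \<forall>e\<in>S. \<not> e \<subseteq> G}))\<^sup>*"
      using con' by (elim imageE) simp
  qed
qed

lemma star_nonempty:
  fixes P :: "'a::euclidean_space set"
  assumes P: "polytope P" "aff_dim P \<ge> 1" and v: "v extreme_point_of P"
  shows "star P v \<noteq> {}"
proof -
  obtain c where c: "\<And>y. y \<in> P \<Longrightarrow> y \<noteq> v \<Longrightarrow> c \<bullet> y < c \<bullet> v"
    using extreme_point_exposing[OF P(1) v] by blast
  have "\<not> P \<subseteq> {v}" using P(2) aff_dim_subset[of P "{v}"] by auto
  then obtain z where "z \<in> P" "z \<noteq> v" by blast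
  then obtain y where "(v, y) \<in> down_steps P c" using descent[OF P(1) v] c by blast
  then show ?thesis by (auto simp: down_steps_def star_def)
qed

text \<open>Every edge in both stars is the segment from \<open>v\<close> to \<open>w\<close>, but there is more than one edge at \<open>v\<close>: a
  functional that is maximal exactly on one of them decreases along another.\<close>

lemma star_inj:
  fixes P :: "'a::euclidean_space set"
  assumes P: "polytope P" "aff_dim P \<ge> 2" and v: "v extreme_point_of P" and w: "w extreme_point_of P"
    and eq: "star P v = star P w"
  shows "v = w"
proof (rule ccontr)
  assume "v \<noteq> w"
  have only: "e = closed_segment v w" if e: "e \<in> star P v" for e
  proof -
    obtain u where u: "u extreme_point_of P" "e = closed_segment v u"
      using edge_other_end[OF P(1) _ v, of e] e by (auto simp: star_def)
    have "closed_segment v u \<in> edges P" "w \<in> closed_segment v u"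
      using e eq u by (auto simp: star_def)
    then show ?thesis using edge_extreme_points[OF _ w] \<open>v \<noteq> w\<close> u by blast
  qed
  obtain e where e: "e \<in> star P v" using star_nonempty[OF P(1) _ v] P(2) by fastforce
  then have eP: "e face_of P" "aff_dim e = 1" "v \<in> e" by (auto simp: star_def edges_def)
  obtain c b where c: "P \<subseteq> {y. c \<bullet> y \<le> b}" "e = P \<inter> {y. c \<bullet> y = b}"
    using face_of_polytope_exposed[OF P(1) eP(1)] .
  have "e \<noteq> P" using eP P by auto
  have ce: "c \<bullet> y = c \<bullet> v" if "y \<in> e" for y using that c eP by auto
  obtain z where "z \<in> P" "z \<notin> e" using \<open>e \<noteq> P\<close> face_of_imp_subset[OF eP(1)] by blast
  then have "z \<in> P" "c \<bullet> z < c \<bullet> v" using c eP by fastforce+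
  then obtain f where "f \<in> star P v" "lower_edge c v f"
    using star_descent[OF P(1) v e ce] by blast
  then have "lower_edge c v e" using only e by blast
  then show False using ce by (auto simp: lower_edge_def)
qed

lemma star_in_polygon:
  fixes P :: "'a::euclidean_space set"
  assumes P: "polytope P" and v: "v extreme_point_of P" and G: "G \<in> polygons P"
  shows "card {e \<in> star P v. e \<subseteq> G} = (if v \<in> G then 2 else 0)"
proof (cases "v \<in> G")
  case True
  have GP: "G face_of P" "aff_dim G = 2" using G by (auto simp: polygons_def)
  have "v extreme_point_of G" using extreme_point_of_face[OF GP(1)] v True by blast
  then have "card (star G v) = 2"
    using polygon_vertex_degree[OF face_of_polytope_polytope[OF P GP(1)] GP(2)] by blast
  then show ?thesis using star_of_face[OF GP(1)] True by simp
next
  case False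
  then have "{e \<in> star P v. e \<subseteq> G} = {}" by (auto simp: star_def)
  then have "card {e \<in> star P v. e \<subseteq> G} = 0" by (simp only: card.empty)
  then show ?thesis using False by simp
qed

lemma star_touches_polygon:
  fixes P :: "'a::euclidean_space set"
  assumes P: "polytope P" and v: "v extreme_point_of P" and G: "G \<in> polygons P"
  shows "(\<exists>e\<in>star P v. e \<subseteq> G) \<longleftrightarrow> v \<in> G"
proof
  assume "v \<in> G"
  then have "{e \<in> star P v. e \<subseteq> G} \<noteq> {}" using star_in_polygon[OF P v G] by (metis card.empty zero_neq_numeral)
  then show "\<exists>e\<in>star P v. e \<subseteq> G" by blast
qed (auto simp: star_def)

lemma star_is_star_like:
  fixes P :: "'a::euclidean_space set"
  assumes P: "polytope P" "aff_dim P \<ge> 3" and v: "v extreme_point_of P"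
  shows "star_like (edges P) (polygons P) (star P v)"
proof -
  obtain c where c: "\<And>y. y \<in> P \<Longrightarrow> y \<noteq> v \<Longrightarrow> c \<bullet> y < c \<bullet> v"
    using extreme_point_exposing[OF P(1) v] by blast
  have low: "lower_edge c v g" if g: "g \<in> star P v" for g
  proof -
    obtain w where "w \<noteq> v" "w extreme_point_of P" "g = closed_segment v w"
      using edge_other_end[OF P(1) _ v, of g] g by (auto simp: star_def)
    then show ?thesis using c by (auto simp: lower_edge_segment extreme_point_of_def)
  qed
  have sub: "{(e, f). e \<in> star P v \<and> f \<in> star P v \<and> lower_edge c v e \<and> lower_edge c v f \<and> e \<noteq> f \<and>
        (\<exists>G\<in>polygons P. e \<subseteq> G \<and> f \<subseteq> G)} \<subseteq> linked (star P v) (polygons P)"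
    by (auto simp: linked_def)
  have "(e, f) \<in> (linked (star P v) (polygons P))\<^sup>*" if "e \<in> star P v" "f \<in> star P v" for e f
    using lower_star_connected[OF P(1) v that(1) low[OF that(1)] that(2) low[OF that(2)]]
      rtrancl_mono[OF sub] by blast
  moreover have "{G \<in> polygons P. \<forall>e\<in>star P v. \<not> e \<subseteq> G} = {G \<in> polygons P. v \<notin> G}"
    using star_touches_polygon[OF P(1) v] by blast
  moreover have "star P v \<noteq> {}" by (rule star_nonempty[OF P(1) _ v]) (use P(2) in simp)
  moreover have "star P v \<subseteq> edges P" by (auto simp: star_def)
  moreover have "\<forall>G\<in>polygons P. card {e \<in> star P v. e \<subseteq> G} \<in> {0, 2}"
    using star_in_polygon[OF P(1) v] by simp
  ultimately show ?thesis
    unfolding star_like_def using antistar_connected[OF P v] by (metis (no_types, lifting))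
qed

text \<open>By \<open>even_edge_set_is_cut\<close>, \<open>S\<close> is the set of edges between some \<open>A\<close> and its complement. Suppose every
  vertex had an edge outside of \<open>S\<close>. Such edges do not change sides, and neither do polygons without
  edges in \<open>S\<close>, so the connectedness of the edges outside of \<open>S\<close> would put all vertices on the same
  side, and \<open>S\<close> would be empty. So \<open>S\<close> contains the star of some \<open>v\<close>. It contains nothing else: a polygon
  with an edge at \<open>v\<close> has two edges at \<open>v\<close> and no more than two edges in \<open>S\<close>, so a chain of polygons inside
  \<open>S\<close> cannot leave the star.\<close>

lemma star_like_is_star:
  fixes P :: "'a::euclidean_space set"
  assumes P: "polytope P" "aff_dim P \<ge> 1" and S: "star_like (edges P) (polygons P) S"
  obtains v where "v extreme_point_of P" "S = star P v"
proof -
  have SE: "S \<subseteq> edges P" "S \<noteq> {}" and card02: "\<And>G. G \<in> polygons P \<Longrightarrow> card {e \<in> S. e \<subseteq> G} \<in> {0, 2}"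
    and con: "\<And>e f. e \<in> S \<Longrightarrow> f \<in> S \<Longrightarrow> (e, f) \<in> (linked S (polygons P))\<^sup>*"
    and con': "\<And>e f. e \<in> edges P - S \<Longrightarrow> f \<in> edges P - S \<Longrightarrow>
      (e, f) \<in> (linked (edges P - S) {G \<in> polygons P. \<forall>e\<in>S. \<not> e \<subseteq> G})\<^sup>*"
    using S unfolding star_like_def by blast+
  have finS: "finite S" using SE finite_edges[OF P(1)] finite_subset by blast
  have "even (card {e \<in> S. e \<subseteq> G})" if "G \<in> polygons P" for G
    using card02[OF that] by auto
  then obtain A where A: "\<And>u w. closed_segment u w \<in> edges P \<Longrightarrow>
      closed_segment u w \<in> S \<longleftrightarrow> (u \<in> A) \<noteq> (w \<in> A)"
    using even_edge_set_is_cut[OF P(1) _ SE(1)] by blast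
  have "\<exists>v. v extreme_point_of P \<and> star P v \<subseteq> S"
  proof (rule ccontr)
    assume "\<not> ?thesis"
    then have out: "\<exists>e\<in>star P v. e \<notin> S" if "v extreme_point_of P" for v using that by blast
    have same_G: "(x \<in> A) = (y \<in> A)"
      if G: "G \<in> polygons P" "\<forall>e\<in>S. \<not> e \<subseteq> G" and xy: "x extreme_point_of G" "y extreme_point_of G" for G x y
    proof -
      have GP: "G face_of P" using G by (auto simp: polygons_def)
      \<comment> \<open>The zero functional and the level 1 give the connectedness of the whole graph of \<open>G\<close>.\<close>
      have "(x, y) \<in> {(u, w). closed_segment u w \<in> edges G \<and> 0 \<bullet> u < (1::real) \<and> 0 \<bullet> w < (1::real)}\<^sup>*"
        using graph_below_connected[OF face_of_polytope_polytope[OF P(1) GP] xy(1) _ xy(2), of 0 1] by simp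
      then show ?thesis
      proof (induction rule: rtrancl_induct)
        case (step p q)
        then have "closed_segment p q \<in> edges P" "closed_segment p q \<subseteq> G"
          using edges_of_face[OF GP] by auto
        then have "(p \<in> A) = (q \<in> A)" using A G(2) by blast
        then show ?case using step.IH by simp
      qed simp
    qed
    have same_link: "\<forall>x y. x extreme_point_of P \<and> x \<in> e \<and> y extreme_point_of P \<and> y \<in> f \<longrightarrow> (x \<in> A) = (y \<in> A)"
      if e: "e \<in> edges P - S" and f: "f \<in> edges P - S" for e f
      using con'[OF e f]
    proof (induction rule: rtrancl_induct)
      case base
      obtain u w where uw: "e = closed_segment u w" using edge_ends[OF P(1)] e by blast
      then have "(u \<in> A) = (w \<in> A)" using A e by blast
      moreover have "x = u \<or> x = w" if "x extreme_point_of P" "x \<in> e" for x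
        using edge_extreme_points[of u w P x] that e uw by blast
      ultimately show ?case by metis
    next
      case (step p q)
      then obtain G where G: "G \<in> polygons P" "\<forall>e\<in>S. \<not> e \<subseteq> G" "p \<subseteq> G" "q \<subseteq> G"
        and pq: "p \<in> edges P" "q \<in> edges P" by (auto simp: linked_def)
      obtain u w where u: "u extreme_point_of P" "p = closed_segment u w"
        using edge_ends[OF P(1) pq(1)] by metis
      have ext: "z extreme_point_of G" if "z extreme_point_of P" "z \<in> G" for z
        using extreme_point_of_face[of G P z] G(1) that by (simp add: polygons_def)
      have up: "u \<in> p" using u by simp
      have uG: "u extreme_point_of G" using ext[OF u(1)] up G(3) by blast
      show ?case
      proof (intro allI impI, elim conjE)
        fix x y assume x: "x extreme_point_of P" "x \<in> e" and y: "y extreme_point_of P" "y \<in> q"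
        have "y extreme_point_of G" using ext[OF y(1)] y(2) G(4) by blast
        then have "(u \<in> A) = (y \<in> A)" by (rule same_G[OF G(1,2) uG])
        moreover have "(x \<in> A) = (u \<in> A)" using step.IH x u(1) up by blast
        ultimately show "(x \<in> A) = (y \<in> A)" by simp
      qed
    qed
    have same: "(x \<in> A) = (y \<in> A)" if x: "x extreme_point_of P" and y: "y extreme_point_of P" for x y
    proof -
      obtain e f where "e \<in> star P x" "e \<notin> S" "f \<in> star P y" "f \<notin> S" using out x y by blast
      then show ?thesis using same_link[of e f] x y by (auto simp: star_def)
    qed
    obtain e where e: "e \<in> S" "e \<in> edges P" using SE by blast
    then obtain x y where "x extreme_point_of P" "y extreme_point_of P" "e = closed_segment x y"
      using edge_ends[OF P(1)] by metis
    then show False using A e same by blast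
  qed
  then obtain v where v: "v extreme_point_of P" "star P v \<subseteq> S" by blast
  obtain e where e: "e \<in> star P v" using star_nonempty[OF P v(1)] by blast
  have "f \<in> star P v" if f: "f \<in> S" for f
    using con[OF subsetD[OF v(2) e] f]
  proof (induction rule: rtrancl_induct)
    case (step p q)
    then obtain G where G: "G \<in> polygons P" "p \<subseteq> G" "q \<subseteq> G" and q: "q \<in> S"
      by (auto simp: linked_def)
    have "v \<in> G" using step.IH G by (auto simp: star_def)
    then have c2: "card {e \<in> star P v. e \<subseteq> G} = 2" using star_in_polygon[OF P(1) v(1) G(1)] by simp
    have fin: "finite {e \<in> S. e \<subseteq> G}" using finS by simp
    have sub: "{e \<in> star P v. e \<subseteq> G} \<subseteq> {e \<in> S. e \<subseteq> G}" using v by blast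
    have "card {e \<in> S. e \<subseteq> G} \<le> 2" using card02[OF G(1)] by auto
    then have "{e \<in> star P v. e \<subseteq> G} = {e \<in> S. e \<subseteq> G}" using card_seteq[OF fin sub] c2 by simp
    then show ?case using q G by blast
  qed (rule e)
  then show ?thesis using that v by blast
qed

section \<open>Polar duality\<close>

lemma face_one_dim_up:
  fixes P :: "'a::euclidean_space set"
  assumes "polytope P" "F face_of P" "F \<noteq> P"
  obtains G where "G face_of P" "F \<subseteq> G" "aff_dim G = aff_dim F + 1"
proof -
  have "\<exists>G. G face_of P \<and> F \<subseteq> G \<and> aff_dim G = aff_dim F + 1"
    using assms
  proof (induction "nat (aff_dim P + 1)" arbitrary: P rule: less_induct)
    case less
    show ?case
    proof (cases "F = {}")
      case True
      then obtain x where "x extreme_point_of P"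
        using polytope_has_extreme_point less.prems by metis
      then have "{x} face_of P" by (simp add: face_of_singleton)
      then show ?thesis using True by (intro exI[of _ "{x}"]) simp
    next
      case False
      obtain K where K: "K facet_of P" "F \<subseteq> K"
        using face_of_polyhedron_subset_facet[OF polytope_imp_polyhedron] less.prems False by metis
      have Kf: "K face_of P" "aff_dim K = aff_dim P - 1" "K \<noteq> {}" using K by (auto simp: facet_of_def)
      show ?thesis
      proof (cases "F = K")
        case True
        then show ?thesis
          using Kf less.prems face_of_refl[OF polytope_imp_convex] face_of_imp_subset
          by (intro exI[of _ P]) auto
      next
        case False
        have "nat (aff_dim K + 1) < nat (aff_dim P + 1)" using Kf aff_dim_geq[of K] by simp
        moreover have "polytope K" using face_of_polytope_polytope less.prems Kf by blast
        moreover have "F face_of K" using face_of_face[OF Kf(1)] less.prems K by blast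
        ultimately obtain G where "G face_of K" "F \<subseteq> G" "aff_dim G = aff_dim F + 1"
          using less.hyps False by blast
        then show ?thesis using Kf face_of_trans by blast
      qed
    qed
  qed
  then show ?thesis using that by blast
qed

lemma face_one_dim_down:
  fixes F :: "'a::euclidean_space set"
  assumes F: "polytope F" "F \<noteq> {}"
  obtains G where "G face_of F" "aff_dim G = aff_dim F - 1"
proof (cases "aff_dim F = 0")
  case True
  then show ?thesis using that[of "{}"] by simp
next
  case False
  moreover have "aff_dim F \<noteq> -1" using F aff_dim_empty by blast
  ultimately have "0 < aff_dim F" using aff_dim_geq[of F] by linarith
  then obtain G where "G facet_of F" using polytope_facet_exists F by blast
  then show ?thesis using that by (auto simp: facet_of_def)
qed

lemma convex_combination_eq_1:
  fixes p q u :: real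
  assumes "p \<le> 1" "q \<le> 1" "0 < u" "u < 1" "(1 - u) * p + u * q = 1"
  shows "p = 1 \<and> q = 1"
proof -
  have "(1 - u) * (1 - p) + u * (1 - q) = 0" using assms by (simp add: algebra_simps)
  moreover have "(1 - u) * (1 - p) \<ge> 0" "u * (1 - q) \<ge> 0" using assms by auto
  ultimately have "(1 - u) * (1 - p) = 0" "u * (1 - q) = 0" by linarith+
  then show ?thesis using assms by auto
qed

text \<open>The polar is taken with respect to an arbitrary interior point \<open>z\<close> in place of the origin; it is the
  usual polar of the translate of \<open>P\<close> by \<open>-z\<close>.\<close>

locale polar_body =
  fixes P :: "'a::euclidean_space set" and z :: 'a
  assumes full: "full_polytope P" and centre: "z \<in> interior P"
begin

definition polar :: "'a set" where "polar = {y. \<forall>x\<in>P. y \<bullet> (x - z) \<le> 1}"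

definition dual :: "'a set \<Rightarrow> 'a set" where "dual F = {y \<in> polar. \<forall>x\<in>F. y \<bullet> (x - z) = 1}"

definition codual :: "'a set \<Rightarrow> 'a set" where "codual G = {x \<in> P. \<forall>y\<in>G. y \<bullet> (x - z) = 1}"

lemma polytope_P: "polytope P" using full by (simp add: full_polytope_def)

lemma z_in: "z \<in> P" using centre interior_subset by blast

lemma aff_dim_P: "aff_dim P = int DIM('a)"
  using full by (simp add: full_polytope_def flip: aff_dim_eq_full)

text \<open>Only the inequalities of the extreme points of \<open>P\<close> matter, so the polar is a polyhedron. It is
  bounded because \<open>P\<close> contains a ball around \<open>z\<close>.\<close>

lemma polytope_polar: "polytope polar"
proof -
  have eq: "polar = (\<Inter>x\<in>{x. x extreme_point_of P}. {y. (x - z) \<bullet> y \<le> 1})"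
  proof (intro equalityI subsetI)
    fix y assume "y \<in> polar"
    then show "y \<in> (\<Inter>x\<in>{x. x extreme_point_of P}. {y. (x - z) \<bullet> y \<le> 1})"
      by (auto simp: polar_def extreme_point_of_def inner_commute)
  next
    fix y assume y: "y \<in> (\<Inter>x\<in>{x. x extreme_point_of P}. {y. (x - z) \<bullet> y \<le> 1})"
    have "P \<subseteq> {x. y \<bullet> x \<le> 1 + y \<bullet> z}"
    proof (rule polytope_subset_convex[OF polytope_P])
      fix x assume "x extreme_point_of P"
      then have "(x - z) \<bullet> y \<le> 1" using y by blast
      then show "x \<in> {x. y \<bullet> x \<le> 1 + y \<bullet> z}" by (simp add: inner_commute[of "x - z"] inner_diff_right)
    qed (rule convex_halfspace_le)
    then show "y \<in> polar" by (auto simp: polar_def inner_diff_right)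
  qed
  have "polyhedron polar"
    unfolding eq using finite_extreme_points[OF polytope_P]
    by (intro polyhedron_Inter) (auto simp: polyhedron_halfspace_le)
  moreover have "bounded polar"
  proof -
    obtain r where r: "r > 0" "cball z r \<subseteq> P" using centre mem_interior_cball by blast
    have "norm y \<le> 1 / r" if "y \<in> polar" for y
    proof (cases "y = 0")
      case False
      have "z + (r / norm y) *\<^sub>R y \<in> P" using r False by (intro subsetD[OF r(2)]) (simp add: dist_norm)
      then have "y \<bullet> ((r / norm y) *\<^sub>R y) \<le> 1" using that by (force simp: polar_def)
      then have "r * norm y \<le> 1" using False by (simp add: dot_square_norm power2_eq_square)
      then show ?thesis using r by (simp add: field_simps)
    qed (use r in simp)
    then show ?thesis by (auto simp: bounded_iff)
  qed
  ultimately show ?thesis by (simp add: polytope_eq_bounded_polyhedron)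
qed

lemma zero_interior_polar: "0 \<in> interior polar"
proof -
  have "bounded P" by (simp add: polytope_imp_bounded polytope_P)
  then obtain B where B: "B > 0" "\<And>x. x \<in> P \<Longrightarrow> norm x \<le> B" by (auto simp: bounded_pos)
  define C where "C = B + norm z"
  have C: "C > 0" "norm (x - z) \<le> C" if "x \<in> P" for x
    using B(1) B(2)[OF that] norm_triangle_ineq4[of x z] norm_ge_zero[of z] unfolding C_def by linarith+
  have "ball 0 (1 / C) \<subseteq> polar"
  proof
    fix y :: 'a assume "y \<in> ball 0 (1 / C)"
    then have y: "norm y \<le> 1 / C" by simp
    have "y \<bullet> (x - z) \<le> 1" if "x \<in> P" for x
    proof -
      have "y \<bullet> (x - z) \<le> norm y * norm (x - z)" by (rule norm_cauchy_schwarz)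
      also have "\<dots> \<le> (1 / C) * C" using y C[OF that] by (intro mult_mono) auto
      also have "\<dots> = 1" using C(1)[OF that] by simp
      finally show ?thesis .
    qed
    then show "y \<in> polar" by (simp add: polar_def)
  qed
  moreover have "1 / C > 0" using C(1)[OF z_in] by simp
  ultimately show ?thesis unfolding mem_interior by blast
qed

lemma full_polytope_polar: "full_polytope polar"
proof -
  have "interior polar \<noteq> {}" using zero_interior_polar by blast
  then have "affine hull polar = UNIV" by (rule affine_hull_nonempty_interior)
  then show ?thesis using polytope_polar by (simp add: full_polytope_def)
qed

lemma aff_dim_polar: "aff_dim polar = int DIM('a)"
  using full_polytope_polar by (simp add: full_polytope_def flip: aff_dim_eq_full)

text \<open>A hyperplane that separates \<open>x\<close> from \<open>P\<close> can be scaled to a point of the polar that violates the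
  assumption, because \<open>z\<close> is on the same side as \<open>P\<close>.\<close>

lemma bipolar:
  assumes "\<And>y. y \<in> polar \<Longrightarrow> y \<bullet> (x - z) \<le> 1"
  shows "x \<in> P"
proof (rule ccontr)
  assume "x \<notin> P"
  then obtain a b where ab: "a \<bullet> x < b" "\<forall>y\<in>P. b < a \<bullet> y"
    using separating_hyperplane_closed_point[of P x] polytope_P
    by (auto simp: polytope_imp_convex polytope_imp_closed)
  define s where "s = a \<bullet> z - b"
  have s: "s > 0" using ab z_in by (simp add: s_def)
  \<comment> \<open>Normalised such that \<open>{w. y \<bullet> (w - z) = 1}\<close> is the separating hyperplane.\<close>
  define y where "y = (- 1 / s) *\<^sub>R a"
  have yx: "y \<bullet> (w - z) = (a \<bullet> z - a \<bullet> w) / s" for w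
    by (simp add: y_def inner_diff_right diff_divide_distrib)
  have "y \<in> polar" unfolding polar_def
  proof safe
    fix w assume "w \<in> P"
    then have "a \<bullet> z - a \<bullet> w \<le> s" using ab by (simp add: s_def less_imp_le)
    then show "y \<bullet> (w - z) \<le> 1" using s by (simp add: yx)
  qed
  then have "(a \<bullet> z - a \<bullet> x) / s \<le> 1" using assms yx by metis
  then show False using s ab by (simp add: s_def)
qed

lemma dual_antimono: "F \<subseteq> F' \<Longrightarrow> dual F' \<subseteq> dual F"
  by (auto simp: dual_def)

lemma dual_face_of:
  assumes "F \<subseteq> P"
  shows "dual F face_of polar"
  unfolding face_of_def
proof (intro conjI ballI impI)
  show "dual F \<subseteq> polar" by (auto simp: dual_def)
  have "dual F = polar \<inter> (\<Inter>x\<in>F. {y. (x - z) \<bullet> y = 1})" by (auto simp: dual_def inner_commute)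
  then show "convex (dual F)"
    by (simp only:) (intro convex_Int polytope_imp_convex[OF polytope_polar] convex_INT convex_hyperplane)
  fix a b y assume ab: "a \<in> polar" "b \<in> polar" "y \<in> dual F" "y \<in> open_segment a b"
  then obtain u where u: "0 < u" "u < 1" "y = (1 - u) *\<^sub>R a + u *\<^sub>R b" by (auto simp: in_segment)
  have "a \<bullet> (x - z) = 1 \<and> b \<bullet> (x - z) = 1" if "x \<in> F" for x
  proof -
    have "(1 - u) * (a \<bullet> (x - z)) + u * (b \<bullet> (x - z)) = 1"
      using ab(3) that u(3) by (auto simp: dual_def inner_add_left)
    moreover have "a \<bullet> (x - z) \<le> 1" "b \<bullet> (x - z) \<le> 1"
      using ab(1,2) that assms by (auto simp: polar_def)
    ultimately show ?thesis using convex_combination_eq_1 u(1,2) by blast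
  qed
  then show "a \<in> dual F" "b \<in> dual F" using ab by (auto simp: dual_def)
qed

lemma codual_face_of:
  assumes "G \<subseteq> polar"
  shows "codual G face_of P"
  unfolding face_of_def
proof (intro conjI ballI impI)
  show "codual G \<subseteq> P" by (auto simp: codual_def)
  have "codual G = P \<inter> (\<Inter>y\<in>G. {x. y \<bullet> x = 1 + y \<bullet> z})"
    by (auto simp: codual_def inner_diff_right algebra_simps)
  then show "convex (codual G)"
    by (simp only:) (intro convex_Int polytope_imp_convex[OF polytope_P] convex_INT convex_hyperplane)
  fix a b x assume ab: "a \<in> P" "b \<in> P" "x \<in> codual G" "x \<in> open_segment a b"
  then obtain u where u: "0 < u" "u < 1" "x = (1 - u) *\<^sub>R a + u *\<^sub>R b" by (auto simp: in_segment)
  have "y \<bullet> (a - z) = 1 \<and> y \<bullet> (b - z) = 1" if "y \<in> G" for y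
  proof -
    have "x - z = (1 - u) *\<^sub>R (a - z) + u *\<^sub>R (b - z)" using u by (simp add: algebra_simps)
    moreover have "y \<bullet> (x - z) = 1" using ab(3) that by (auto simp: codual_def)
    ultimately have "(1 - u) * (y \<bullet> (a - z)) + u * (y \<bullet> (b - z)) = 1" by (simp add: inner_add_right)
    moreover have "y \<bullet> (a - z) \<le> 1" "y \<bullet> (b - z) \<le> 1"
      using ab(1,2) that assms by (auto simp: polar_def)
    ultimately show ?thesis using convex_combination_eq_1 u(1,2) by blast
  qed
  then show "a \<in> codual G" "b \<in> codual G" using ab by (auto simp: codual_def)
qed

lemma dual_empty [simp]: "dual {} = polar"
  by (simp add: dual_def)

lemma dual_P [simp]: "dual P = {}"
  using z_in by (force simp: dual_def)

text \<open>A supporting hyperplane of \<open>P\<close> that cuts out \<open>F\<close> does not contain the interior point \<open>z\<close>, so it can be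
  scaled to a point \<open>y\<close> of the polar. This \<open>y\<close> lies in the dual face and excludes all points outside
  of \<open>F\<close>.\<close>

lemma codual_dual:
  assumes F: "F face_of P"
  shows "codual (dual F) = F"
proof
  show "F \<subseteq> codual (dual F)" using face_of_imp_subset[OF F] by (auto simp: codual_def dual_def)
  consider "F = {}" | "F = P" | "F \<noteq> {}" "F \<noteq> P" by blast
  then show "codual (dual F) \<subseteq> F"
  proof cases
    case 1
    have "0 \<in> polar" using zero_interior_polar interior_subset by blast
    then show ?thesis using 1 by (force simp: codual_def)
  next
    case 2
    then show ?thesis by (auto simp: codual_def)
  next
    case 3
    obtain a b where ab: "P \<subseteq> {x. a \<bullet> x \<le> b}" "F = P \<inter> {x. a \<bullet> x = b}"
      using face_of_polytope_exposed[OF polytope_P F] .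
    have "z \<notin> F" using face_of_disjoint_interior[OF F 3(2)] centre by blast
    define s where "s = b - a \<bullet> z"
    have s: "s > 0" using ab z_in \<open>z \<notin> F\<close> by (auto simp: s_def order_less_le)
    define y where "y = (1 / s) *\<^sub>R a"
    have yx: "y \<bullet> (w - z) = (a \<bullet> w - a \<bullet> z) / s" for w
      by (simp add: y_def inner_diff_right diff_divide_distrib)
    have "y \<in> polar" using ab s by (auto simp: polar_def yx s_def)
    moreover have "y \<bullet> (w - z) = 1" if "w \<in> F" for w using that ab s by (auto simp: yx s_def)
    ultimately have "y \<in> dual F" by (auto simp: dual_def)
    moreover have "w \<in> F" if "w \<in> P" "y \<bullet> (w - z) = 1" for w
      using that ab s by (auto simp: yx s_def)
    ultimately show ?thesis by (auto simp: codual_def)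
  qed
qed

text \<open>As for \<open>codual_dual\<close>, with the roles of \<open>P\<close> and its polar exchanged: the scaled normal vector of a
  supporting hyperplane gives a point of \<open>P\<close> by \<open>bipolar\<close>.\<close>

lemma dual_codual:
  assumes G: "G face_of polar"
  shows "dual (codual G) = G"
proof
  show "G \<subseteq> dual (codual G)" using face_of_imp_subset[OF G] by (auto simp: codual_def dual_def)
  consider "G = {}" | "G = polar" | "G \<noteq> {}" "G \<noteq> polar" by blast
  then show "dual (codual G) \<subseteq> G"
  proof cases
    case 1
    then have "codual G = P" by (auto simp: codual_def)
    then show ?thesis using 1 by simp
  next
    case 2
    then show ?thesis by (auto simp: dual_def)
  next
    case 3
    obtain a b where ab: "polar \<subseteq> {y. a \<bullet> y \<le> b}" "G = polar \<inter> {y. a \<bullet> y = b}"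
      using face_of_polytope_exposed[OF polytope_polar G] .
    have "0 \<notin> G" using face_of_disjoint_interior[OF G 3(2)] zero_interior_polar by blast
    moreover have "0 \<in> polar" using zero_interior_polar interior_subset by blast
    ultimately have b: "b > 0" using ab by (auto simp: order_less_le)
    define x where "x = z + (1 / b) *\<^sub>R a"
    have yx: "y \<bullet> (x - z) = (a \<bullet> y) / b" for y by (simp add: x_def inner_commute)
    have "x \<in> P" by (rule bipolar) (use ab b in \<open>auto simp: yx\<close>)
    moreover have "y \<bullet> (x - z) = 1" if "y \<in> G" for y using that ab b by (auto simp: yx)
    ultimately have "x \<in> codual G" by (auto simp: codual_def)
    then show ?thesis using ab b by (auto simp: dual_def yx)
  qed
qed

lemma dual_subset_iff:
  assumes "F face_of P" "F' face_of P"
  shows "dual F' \<subseteq> dual F \<longleftrightarrow> F \<subseteq> F'"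
proof
  assume "dual F' \<subseteq> dual F"
  then have "codual (dual F) \<subseteq> codual (dual F')" by (auto simp: codual_def)
  then show "F \<subseteq> F'" using assms by (simp add: codual_dual)
qed (rule dual_antimono)

lemma dual_eq_iff:
  assumes "F face_of P" "F' face_of P"
  shows "dual F = dual F' \<longleftrightarrow> F = F'"
  using assms codual_dual by metis

lemma bij_dual: "bij_betw dual {F. F face_of P} {G. G face_of polar}"
proof (rule bij_betwI[where g = codual])
  show "codual \<in> {G. G face_of polar} \<rightarrow> {F. F face_of P}"
    using codual_face_of face_of_imp_subset by blast
qed (auto simp: dual_face_of face_of_imp_subset codual_dual dual_codual)

lemma dual_strict:
  assumes F: "F face_of P" and F': "F' face_of P" and sub: "F \<subseteq> F'" "F \<noteq> F'"
  shows "aff_dim (dual F') < aff_dim (dual F)"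
  using face_proper_dim[OF polytope_polar dual_face_of dual_face_of, of F' F] dual_subset_iff[OF F F']
    face_of_imp_subset[OF F] face_of_imp_subset[OF F']
    dual_eq_iff[OF F F'] sub by blast

text \<open>Dimensions grow strictly along strict inclusions of faces, and duality reverses these. A chain of
  faces from the empty set to \<open>F\<close> in steps of one dimension bounds the dimension of the dual from
  above, and such a chain from \<open>F\<close> to \<open>P\<close> bounds it from below.\<close>

lemma aff_dim_dual:
  assumes F: "F face_of P"
  shows "aff_dim (dual F) = int DIM('a) - 1 - aff_dim F"
proof (rule antisym)
  show "aff_dim (dual F) \<le> int DIM('a) - 1 - aff_dim F"
    using F
  proof (induction "nat (aff_dim F + 1)" arbitrary: F rule: less_induct)
    case less
    show ?case
    proof (cases "F = {}")
      case True then show ?thesis by (simp add: aff_dim_polar)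
    next
      case False
      then obtain G where G: "G face_of F" "aff_dim G = aff_dim F - 1"
        using face_one_dim_down face_of_polytope_polytope[OF polytope_P less.prems] by blast
      have GP: "G face_of P" using G less.prems face_of_trans by blast
      have "nat (aff_dim G + 1) < nat (aff_dim F + 1)" using G aff_dim_geq[of G] by simp
      then have "aff_dim (dual G) \<le> int DIM('a) - 1 - aff_dim G" using less.hyps GP by blast
      moreover have "aff_dim (dual F) < aff_dim (dual G)"
        by (rule dual_strict[OF GP less.prems face_of_imp_subset[OF G(1)]]) (use G in auto)
      ultimately show ?thesis using G by simp
    qed
  qed
  show "int DIM('a) - 1 - aff_dim F \<le> aff_dim (dual F)"
    using F
  proof (induction "nat (int DIM('a) - aff_dim F)" arbitrary: F rule: less_induct)
    case less
    show ?case
    proof (cases "F = P")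
      case True then show ?thesis by (simp add: aff_dim_P)
    next
      case False
      then obtain G where G: "G face_of P" "F \<subseteq> G" "aff_dim G = aff_dim F + 1"
        using face_one_dim_up[OF polytope_P less.prems] by blast
      have "aff_dim G \<le> int DIM('a)" using aff_dim_le_DIM by blast
      then have "nat (int DIM('a) - aff_dim G) < nat (int DIM('a) - aff_dim F)" using G by simp
      then have "int DIM('a) - 1 - aff_dim G \<le> aff_dim (dual G)" using less.hyps G by blast
      moreover have "aff_dim (dual G) < aff_dim (dual F)"
        by (rule dual_strict[OF less.prems G(1,2)]) (use G in auto)
      ultimately show ?thesis using G by simp
    qed
  qed
qed

end

lemma polar_exists:
  fixes P :: "'a::euclidean_space set"
  assumes "full_polytope P"
  obtains z where "polar_body P z"
proof -
  have "interior P \<noteq> {}"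
    using assms rel_interior_interior[of P] rel_interior_eq_empty[of P]
    by (auto simp: full_polytope_def polytope_imp_convex)
  then show ?thesis using that assms unfolding polar_body_def by blast
qed

section \<open>Extending the isomorphism\<close>

definition skel :: "'a::euclidean_space set \<Rightarrow> 'a set set"
  where "skel P = edges P \<union> polygons P"

lemma skeleton_eq_skel: "full_polytope P \<Longrightarrow> skeleton 1 2 P = skel P"
proof -
  assume P: "full_polytope P"
  have "{1..2::nat} = {1, 2}" by auto
  then show ?thesis
    by (auto simp: skeleton_def k_faces_def faces_eq_face_of[OF P] skel_def edges_def polygons_def)
qed

lemma skel_iff: "X \<in> skel P \<longleftrightarrow> X face_of P \<and> (aff_dim X = 1 \<or> aff_dim X = 2)"
  by (auto simp: skel_def edges_def polygons_def)

lemma poset_iso_inv: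
  assumes "poset_iso A B f"
  shows "poset_iso B A (inv_into A f)"
proof -
  have bij: "bij_betw f A B" and ord: "\<And>x y. x \<in> A \<Longrightarrow> y \<in> A \<Longrightarrow> x \<le> y \<longleftrightarrow> f x \<le> f y"
    using assms by (auto simp: poset_iso_def)
  have B: "inv_into A f x \<in> A" "f (inv_into A f x) = x" if "x \<in> B" for x
    using bij that by (auto simp: bij_betw_def inv_into_into f_inv_into_f)
  show ?thesis
    unfolding poset_iso_def using bij_betw_inv_into[OF bij] B ord by metis
qed

text \<open>Edges are minimal in the skeleton, whereas a polygon strictly contains an edge.\<close>

lemma iso_edge:
  fixes P Q :: "'a::euclidean_space set"
  assumes P: "polytope P" and Q: "polytope Q" and iso: "poset_iso (skel P) (skel Q) \<phi>"
    and e: "e \<in> edges P"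
  shows "\<phi> e \<in> edges Q"
proof (rule ccontr)
  have bij: "bij_betw \<phi> (skel P) (skel Q)"
    and ord: "\<And>x y. x \<in> skel P \<Longrightarrow> y \<in> skel P \<Longrightarrow> x \<subseteq> y \<longleftrightarrow> \<phi> x \<subseteq> \<phi> y"
    using iso by (auto simp: poset_iso_def)
  assume "\<not> ?thesis"
  moreover have eP: "e \<in> skel P" using e by (simp add: skel_def)
  then have "\<phi> e \<in> skel Q" using bij by (auto simp: bij_betw_def)
  ultimately have G: "\<phi> e face_of Q" "aff_dim (\<phi> e) = 2" by (auto simp: skel_def polygons_def)
  have pG: "polytope (\<phi> e)" by (rule face_of_polytope_polytope[OF Q G(1)])
  have "\<phi> e \<noteq> {}" using G by auto
  then obtain v where "v extreme_point_of \<phi> e" using polytope_has_extreme_point pG by blast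
  then obtain f where f: "f \<in> edges (\<phi> e)" using star_nonempty[OF pG] G by (auto simp: star_def)
  then have fQ: "f \<in> edges Q" "f \<subseteq> \<phi> e" using edges_of_face[OF G(1)] by auto
  then have "f \<in> \<phi> ` skel P" using bij by (simp add: bij_betw_def skel_def)
  then obtain x where x: "x \<in> skel P" "f = \<phi> x" by blast
  have "x \<subseteq> e" using ord[OF x(1) eP] fQ x by simp
  moreover have "x \<noteq> e" using fQ x G by (auto simp: edges_def)
  moreover have "x face_of P" "e face_of P" using x e by (auto simp: skel_iff edges_def)
  ultimately have "aff_dim x < aff_dim e" by (intro face_proper_dim[OF P])
  then show False using x e by (auto simp: skel_iff edges_def)
qed

lemma iso_edges_polygons:
  fixes P Q :: "'a::euclidean_space set"
  assumes P: "polytope P" and Q: "polytope Q" and iso: "poset_iso (skel P) (skel Q) \<phi>"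
  shows "\<phi> ` edges P = edges Q" "\<phi> ` polygons P = polygons Q"
proof -
  have bij: "bij_betw \<phi> (skel P) (skel Q)" using iso by (auto simp: poset_iso_def)
  show E: "\<phi> ` edges P = edges Q"
  proof
    show "\<phi> ` edges P \<subseteq> edges Q" using iso_edge[OF P Q iso] by blast
    show "edges Q \<subseteq> \<phi> ` edges P"
    proof
      fix f assume f: "f \<in> edges Q"
      then have "inv_into (skel P) \<phi> f \<in> edges P" using iso_edge[OF Q P poset_iso_inv[OF iso]] by blast
      moreover have "\<phi> (inv_into (skel P) \<phi> f) = f"
        using bij f by (auto simp: bij_betw_def skel_def f_inv_into_f)
      ultimately show "f \<in> \<phi> ` edges P" by force
    qed
  qed
  have disj: "polygons P = skel P - edges P" for P :: "'a set"
    by (auto simp: skel_def edges_def polygons_def)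
  have "\<phi> ` (skel P - edges P) = \<phi> ` skel P - \<phi> ` edges P"
    using bij by (intro inj_on_image_set_diff[where C = "skel P"]) (auto simp: bij_betw_def skel_def)
  then show "\<phi> ` polygons P = polygons Q" using E bij by (simp add: disj bij_betw_def)
qed

text \<open>The description \<open>star_like\<close> is in terms of the incidences of edges and polygons, so \<open>\<phi>\<close> maps the star
  of \<open>v\<close> to the star of some \<open>w\<close>. A polygon contains a vertex iff it contains an edge of its star, which
  carries the correspondence over to polygons.\<close>

theorem vertex_transfer:
  fixes P Q :: "'a::euclidean_space set"
  assumes P: "polytope P" "aff_dim P \<ge> 3" and Q: "polytope Q" "aff_dim Q \<ge> 3"
    and iso: "poset_iso (skel P) (skel Q) \<phi>" and v: "v extreme_point_of P"
  obtains w where "w extreme_point_of Q" "\<And>X. X \<in> skel P \<Longrightarrow> w \<in> \<phi> X \<longleftrightarrow> v \<in> X"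
proof -
  have bij: "bij_betw \<phi> (skel P) (skel Q)"
    and ord: "\<And>x y. x \<in> skel P \<Longrightarrow> y \<in> skel P \<Longrightarrow> x \<subseteq> y \<longleftrightarrow> \<phi> x \<subseteq> \<phi> y"
    using iso by (auto simp: poset_iso_def)
  note im = iso_edges_polygons[OF P(1) Q(1) iso]
  have inj: "inj_on \<phi> (skel P)" using bij by (simp add: bij_betw_def)
  then have injE: "inj_on \<phi> (edges P)" by (rule inj_on_subset) (auto simp: skel_def)
  have "star_like (\<phi> ` edges P) (\<phi> ` polygons P) (\<phi> ` star P v)"
    by (rule star_like_image[OF injE _ star_is_star_like[OF P v]]) (use ord in \<open>auto simp: skel_def\<close>)
  then have "star_like (edges Q) (polygons Q) (\<phi> ` star P v)" by (simp only: im)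
  then obtain w where w: "w extreme_point_of Q" "\<phi> ` star P v = star Q w"
    by (rule star_like_is_star[OF Q(1), rotated]) (use Q(2) in auto)
  have sub: "star P v \<subseteq> skel P" by (auto simp: star_def skel_def)
  have "w \<in> \<phi> X \<longleftrightarrow> v \<in> X" if X: "X \<in> skel P" for X
  proof (cases "X \<in> edges P")
    case True
    then have "\<phi> X \<in> edges Q" using im by blast
    then have "w \<in> \<phi> X \<longleftrightarrow> \<phi> X \<in> \<phi> ` star P v" unfolding w(2) by (simp add: star_def)
    also have "\<dots> \<longleftrightarrow> X \<in> star P v" by (rule inj_on_image_mem_iff[OF inj X sub])
    finally show ?thesis using True by (simp add: star_def)
  next
    case False
    then have XP: "X \<in> polygons P" using X by (simp add: skel_def)
    then have "\<phi> X \<in> polygons Q" using im by blast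
    then have "w \<in> \<phi> X \<longleftrightarrow> (\<exists>f\<in>\<phi> ` star P v. f \<subseteq> \<phi> X)"
      unfolding w(2) using star_touches_polygon[OF Q(1) w(1)] by blast
    also have "\<dots> \<longleftrightarrow> (\<exists>e\<in>star P v. e \<subseteq> X)" using ord[OF subsetD[OF sub] X] by simp
    also have "\<dots> \<longleftrightarrow> v \<in> X" by (rule star_touches_polygon[OF P(1) v XP])
    finally show ?thesis .
  qed
  then show ?thesis using that w by blast
qed

lemma (in polar_body) dual_skel:
  assumes "DIM('a) = 4"
  shows "bij_betw dual (skel P) (skel polar)"
proof -
  have "dual ` skel P = skel polar"
  proof (intro equalityI subsetI)
    fix Y assume "Y \<in> dual ` skel P"
    then show "Y \<in> skel polar"
      using assms by (auto simp: skel_iff aff_dim_dual dual_face_of face_of_imp_subset)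
  next
    fix Y assume Y: "Y \<in> skel polar"
    then obtain X where X: "X face_of P" "Y = dual X"
      using bij_dual by (auto simp: bij_betw_def skel_iff image_iff set_eq_iff)
    then have "X \<in> skel P" using Y assms aff_dim_dual[OF X(1)] by (auto simp: skel_iff)
    then show "Y \<in> dual ` skel P" using X by blast
  qed
  moreover have "inj_on dual (skel P)" using dual_eq_iff by (auto simp: inj_on_def skel_iff)
  ultimately show ?thesis by (simp add: bij_betw_def)
qed

lemma (in polar_body) dual_facet:
  assumes F: "F face_of P" "aff_dim F = int DIM('a) - 1"
  obtains v where "v extreme_point_of polar" "dual F = {v}"
proof -
  have "aff_dim (dual F) = 0" using aff_dim_dual[OF F(1)] F(2) by simp
  then obtain v where v: "dual F = {v}" using aff_dim_eq_0 by blast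
  then have "v extreme_point_of polar"
    using dual_face_of[OF face_of_imp_subset[OF F(1)]] by (simp add: face_of_singleton)
  then show ?thesis using that v by blast
qed

text \<open>In dimension 4, polar duality exchanges edges with polygons and vertices with facets. So \<open>\<phi>\<close> induces an
  isomorphism \<open>\<psi>\<close> between the skeletons of the polars, and the claim is \<open>vertex_transfer\<close> for \<open>\<psi>\<close>.\<close>

lemma facet_transfer:
  fixes P Q :: "'a::euclidean_space set"
  assumes dim: "DIM('a) = 4" and P: "full_polytope P" and Q: "full_polytope Q"
    and iso: "poset_iso (skel P) (skel Q) \<phi>" and F: "F face_of P" "aff_dim F = 3"
  obtains F' where "F' face_of Q" "aff_dim F' = 3" "\<And>X. X \<in> skel P \<Longrightarrow> \<phi> X \<subseteq> F' \<longleftrightarrow> X \<subseteq> F"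
proof -
  obtain z where "polar_body P z" using polar_exists[OF P] .
  then interpret p: polar_body P z .
  obtain z' where "polar_body Q z'" using polar_exists[OF Q] .
  then interpret q: polar_body Q z' .
  have bij: "bij_betw \<phi> (skel P) (skel Q)"
    and ord: "\<And>x y. x \<in> skel P \<Longrightarrow> y \<in> skel P \<Longrightarrow> x \<subseteq> y \<longleftrightarrow> \<phi> x \<subseteq> \<phi> y"
    using iso by (auto simp: poset_iso_def)
  define \<psi> where "\<psi> = q.dual \<circ> \<phi> \<circ> inv_into (skel P) p.dual"
  note bp = p.dual_skel[OF dim] and bq = q.dual_skel[OF dim]
  have inv: "inv_into (skel P) p.dual (p.dual X) = X" if "X \<in> skel P" for X
    using bp that by (simp add: bij_betw_inv_into_left)
  have face: "X face_of P" if "X \<in> skel P" for X using that by (simp add: skel_iff)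
  have face': "\<phi> X face_of Q" if "X \<in> skel P" for X
    using bij_betwE[OF bij] that by (simp add: skel_iff)
  have \<psi>: "\<psi> (p.dual X) = q.dual (\<phi> X)" if "X \<in> skel P" for X
    using inv[OF that] by (simp add: \<psi>_def)
  have "bij_betw \<psi> (skel p.polar) (skel q.polar)"
    unfolding \<psi>_def by (intro bij_betw_trans[OF bij_betw_inv_into[OF bp]] bij_betw_trans[OF bij] bq)
  moreover have "Y \<subseteq> Y' \<longleftrightarrow> \<psi> Y \<subseteq> \<psi> Y'" if Y: "Y \<in> skel p.polar" "Y' \<in> skel p.polar" for Y Y'
  proof -
    have "Y \<in> p.dual ` skel P" "Y' \<in> p.dual ` skel P" using Y bp by (auto simp: bij_betw_def)
    then obtain X X' where X: "X \<in> skel P" "X' \<in> skel P" "Y = p.dual X" "Y' = p.dual X'" by blast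
    have "p.dual X \<subseteq> p.dual X' \<longleftrightarrow> X' \<subseteq> X" using X face by (intro p.dual_subset_iff) auto
    moreover have "q.dual (\<phi> X) \<subseteq> q.dual (\<phi> X') \<longleftrightarrow> \<phi> X' \<subseteq> \<phi> X"
      using X face' by (intro q.dual_subset_iff) auto
    ultimately show ?thesis using X \<psi> ord by simp
  qed
  ultimately have iso': "poset_iso (skel p.polar) (skel q.polar) \<psi>" by (auto simp: poset_iso_def)
  obtain v where v: "v extreme_point_of p.polar" "p.dual F = {v}"
    using p.dual_facet[OF F(1)] F(2) dim by auto
  obtain w where w: "w extreme_point_of q.polar" "\<And>Y. Y \<in> skel p.polar \<Longrightarrow> w \<in> \<psi> Y \<longleftrightarrow> v \<in> Y"
    using vertex_transfer[OF p.polytope_polar _ q.polytope_polar _ iso' v(1)]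
      p.aff_dim_polar q.aff_dim_polar dim by auto
  have wf: "{w} face_of q.polar" using w by (simp add: face_of_singleton)
  define F' where "F' = q.codual {w}"
  have F': "F' face_of Q" unfolding F'_def using face_of_imp_subset[OF wf] by (rule q.codual_face_of)
  have dF': "q.dual F' = {w}" unfolding F'_def by (rule q.dual_codual[OF wf])
  have "aff_dim F' = 3" using q.aff_dim_dual[OF F'] dF' dim by simp
  moreover have "\<phi> X \<subseteq> F' \<longleftrightarrow> X \<subseteq> F" if X: "X \<in> skel P" for X
  proof -
    have "\<phi> X \<subseteq> F' \<longleftrightarrow> w \<in> q.dual (\<phi> X)"
      using q.dual_subset_iff[OF face'[OF X] F'] dF' by simp
    also have "\<dots> \<longleftrightarrow> v \<in> p.dual X"
      using w(2)[of "p.dual X"] X bp \<psi>[OF X] by (auto simp: bij_betw_def)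
    also have "\<dots> \<longleftrightarrow> X \<subseteq> F" using p.dual_subset_iff[OF face[OF X] F(1)] v by simp
    finally show ?thesis .
  qed
  ultimately show ?thesis using that F' by blast
qed

text \<open>The dual form of \<open>star_inj\<close>.\<close>

lemma facet_determined:
  fixes P :: "'a::euclidean_space set"
  assumes dim: "DIM('a) = 4" and P: "full_polytope P"
    and F: "F face_of P" "aff_dim F = 3" and F': "F' face_of P" "aff_dim F' = 3"
    and eq: "\<And>G. G \<in> skel P \<Longrightarrow> G \<subseteq> F \<longleftrightarrow> G \<subseteq> F'"
  shows "F = F'"
proof -
  obtain z where "polar_body P z" using polar_exists[OF P] .
  then interpret p: polar_body P z .
  obtain v where v: "v extreme_point_of p.polar" "p.dual F = {v}"
    using p.dual_facet[OF F(1)] F(2) dim by auto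
  obtain w where w: "w extreme_point_of p.polar" "p.dual F' = {w}"
    using p.dual_facet[OF F'(1)] F'(2) dim by auto
  have "v \<in> Y \<longleftrightarrow> w \<in> Y" if Y: "Y \<in> edges p.polar" for Y
  proof -
    obtain X where X: "X \<in> skel P" "Y = p.dual X"
      using Y p.dual_skel[OF dim] by (auto simp: bij_betw_def skel_def)
    then have Xf: "X face_of P" by (simp add: skel_iff)
    show ?thesis
      using p.dual_subset_iff[OF Xf F(1)] p.dual_subset_iff[OF Xf F'(1)] v w X eq by simp
  qed
  then have "star p.polar v = star p.polar w" by (auto simp: star_def)
  then have "v = w" using star_inj[OF p.polytope_polar _ v(1) w(1)] p.aff_dim_polar dim by simp
  then show ?thesis using v w p.dual_eq_iff[OF F(1) F'(1)] by simp
qed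

text \<open>A vertex is recognised by the edges and polygons above it, a facet by those below it. Recording
  both directions for every face, together with the dimension, treats all faces alike and makes the
  relation symmetric in \<open>P\<close> and \<open>Q\<close>; see \<open>corresponds_inv\<close>.\<close>

definition corresponds ::
  "'a::euclidean_space set \<Rightarrow> 'a set \<Rightarrow> ('a set \<Rightarrow> 'a set) \<Rightarrow> 'a set \<Rightarrow> 'a set \<Rightarrow> bool"
  where "corresponds P Q \<phi> F F' \<longleftrightarrow> F face_of P \<and> F' face_of Q \<and> aff_dim F = aff_dim F' \<and>
    (\<forall>X\<in>skel P. (F \<subseteq> X \<longleftrightarrow> F' \<subseteq> \<phi> X) \<and> (X \<subseteq> F \<longleftrightarrow> \<phi> X \<subseteq> F'))"

lemma corresponds_inv:
  assumes "bij_betw \<phi> (skel P) (skel Q)" "corresponds P Q \<phi> F F'"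
  shows "corresponds Q P (inv_into (skel P) \<phi>) F' F"
proof -
  have "inv_into (skel P) \<phi> X \<in> skel P" "\<phi> (inv_into (skel P) \<phi> X) = X" if "X \<in> skel Q" for X
    using assms(1) that by (auto simp: bij_betw_def inv_into_into f_inv_into_f)
  then show ?thesis using assms(2) unfolding corresponds_def by metis
qed

lemma face_dim_eq:
  fixes P :: "'a::euclidean_space set"
  assumes "polytope P" "F face_of P" "aff_dim F = aff_dim P"
  shows "F = P"
  using face_of_aff_dim_lt[OF polytope_imp_convex[OF assms(1)] assms(2)] assms(3) by auto

text \<open>By the dimension of \<open>F\<close>: the partner is the empty face, the vertex from \<open>vertex_transfer\<close>, \<open>\<phi> F\<close>, the
  facet from \<open>facet_transfer\<close>, or \<open>Q\<close>.\<close>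

lemma corresponds_exists:
  fixes P Q :: "'a::euclidean_space set"
  assumes dim: "DIM('a) = 4" and P: "full_polytope P" and Q: "full_polytope Q"
    and iso: "poset_iso (skel P) (skel Q) \<phi>" and F: "F face_of P"
  obtains F' where "corresponds P Q \<phi> F F'"
proof -
  have pP: "polytope P" "aff_dim P = 4" and pQ: "polytope Q" "aff_dim Q = 4"
    using P Q dim by (auto simp: full_polytope_def simp flip: aff_dim_eq_full)
  have bij: "bij_betw \<phi> (skel P) (skel Q)"
    and ord: "\<And>x y. x \<in> skel P \<Longrightarrow> y \<in> skel P \<Longrightarrow> x \<subseteq> y \<longleftrightarrow> \<phi> x \<subseteq> \<phi> y"
    using iso by (auto simp: poset_iso_def)
  have im: "\<phi> X \<in> skel Q" if "X \<in> skel P" for X using bij that by (auto simp: bij_betw_def)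
  have ne: "X \<noteq> {}" "\<phi> X \<noteq> {}" "aff_dim X \<in> {1, 2}" "aff_dim (\<phi> X) \<in> {1, 2}" if "X \<in> skel P" for X
    using that im[OF that] by (auto simp: skel_iff)
  have not_sub: "\<not> X \<subseteq> Y" if "aff_dim Y < aff_dim X" for X Y :: "'a set"
    using aff_dim_subset[of X Y] that by auto
  have range: "aff_dim F \<ge> -1" "aff_dim F \<le> 4" using aff_dim_geq[of F] aff_dim_le_DIM[of F] dim by auto
  have "\<exists>F'. corresponds P Q \<phi> F F'"
  proof -
    consider "F = {}" | "aff_dim F = 0" | "F \<in> skel P" | "aff_dim F = 3" | "F = P"
    proof -
      have "aff_dim F = -1 \<or> aff_dim F = 0 \<or> aff_dim F = 1 \<or> aff_dim F = 2 \<or> aff_dim F = 3 \<or> aff_dim F = 4"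
        using range by linarith
      moreover have "F = P" if "aff_dim F = 4" using face_dim_eq[OF pP(1) F] that pP(2) by simp
      moreover have "F \<in> skel P" if "aff_dim F = 1 \<or> aff_dim F = 2" using F that by (simp add: skel_iff)
      moreover have "F = {}" if "aff_dim F = -1" using that by (simp add: aff_dim_empty)
      ultimately show thesis using that by blast
    qed
    then show ?thesis
    proof cases
      case 1
      then have "corresponds P Q \<phi> F {}" using ne by (auto simp: corresponds_def)
      then show ?thesis by blast
    next
      case 2
      then obtain v where v: "F = {v}" using aff_dim_eq_0 by blast
      then have "v extreme_point_of P" using F by (simp add: face_of_singleton)
      then obtain w where w: "w extreme_point_of Q" "\<And>X. X \<in> skel P \<Longrightarrow> w \<in> \<phi> X \<longleftrightarrow> v \<in> X"
        using vertex_transfer[OF pP(1) _ pQ(1) _ iso] pP pQ by auto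
      have "\<not> X \<subseteq> {v}" "\<not> \<phi> X \<subseteq> {w}" if "X \<in> skel P" for X
        using ne(3,4)[OF that] by (auto intro!: not_sub simp del: subset_singleton_iff)
      then have "corresponds P Q \<phi> F {w}"
        using F v w by (auto simp: corresponds_def face_of_singleton)
      then show ?thesis by blast
    next
      case 3
      have "aff_dim F = aff_dim (\<phi> F)"
        using iso_edges_polygons[OF pP(1) pQ(1) iso] 3 by (auto simp: skel_def edges_def polygons_def)
      then have "corresponds P Q \<phi> F (\<phi> F)"
        using F im[OF 3] ord 3 by (simp add: corresponds_def skel_iff)
      then show ?thesis by blast
    next
      case 4
      obtain F' where F': "F' face_of Q" "aff_dim F' = 3" "\<And>X. X \<in> skel P \<Longrightarrow> \<phi> X \<subseteq> F' \<longleftrightarrow> X \<subseteq> F"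
        using facet_transfer[OF dim P Q iso F 4] by blast
      have "\<not> F \<subseteq> X" "\<not> F' \<subseteq> \<phi> X" if "X \<in> skel P" for X
        using ne(3,4)[OF that] 4 F' by (auto intro!: not_sub)
      then have "corresponds P Q \<phi> F F'" using F F' 4 by (simp add: corresponds_def)
      then show ?thesis by blast
    next
      case 5
      have "\<not> P \<subseteq> X" "\<not> Q \<subseteq> \<phi> X" if "X \<in> skel P" for X
        using ne(3,4)[OF that] pP pQ by (auto intro!: not_sub)
      moreover have "X \<subseteq> P" "\<phi> X \<subseteq> Q" if "X \<in> skel P" for X
        using that im[OF that] face_of_imp_subset by (auto simp: skel_iff)
      ultimately have "corresponds P Q \<phi> F Q"
        using 5 pP pQ by (auto simp: corresponds_def face_of_refl polytope_imp_convex)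
      then show ?thesis by blast
    qed
  qed
  then show ?thesis using that by blast
qed

lemma corresponds_unique:
  fixes P Q :: "'a::euclidean_space set"
  assumes dim: "DIM('a) = 4" and P: "full_polytope P" and Q: "full_polytope Q"
    and bij: "bij_betw \<phi> (skel P) (skel Q)"
    and F1: "corresponds P Q \<phi> F F1" and F2: "corresponds P Q \<phi> F F2"
  shows "F1 = F2"
proof -
  have pQ: "polytope Q" "aff_dim Q = 4"
    using Q dim by (auto simp: full_polytope_def simp flip: aff_dim_eq_full)
  have f1: "F1 face_of Q" "aff_dim F1 = aff_dim F" and f2: "F2 face_of Q" "aff_dim F2 = aff_dim F"
    using F1 F2 by (auto simp: corresponds_def)
  have up: "F1 \<subseteq> Y \<longleftrightarrow> F2 \<subseteq> Y" and down: "Y \<subseteq> F1 \<longleftrightarrow> Y \<subseteq> F2" if "Y \<in> skel Q" for Y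
  proof -
    obtain X where "X \<in> skel P" "Y = \<phi> X" using bij \<open>Y \<in> skel Q\<close> by (auto simp: bij_betw_def)
    then show "F1 \<subseteq> Y \<longleftrightarrow> F2 \<subseteq> Y" "Y \<subseteq> F1 \<longleftrightarrow> Y \<subseteq> F2" using F1 F2 by (auto simp: corresponds_def)
  qed
  have range: "aff_dim F \<ge> -1" "aff_dim F \<le> 4" using aff_dim_geq[of F] aff_dim_le_DIM[of F] dim by auto
  then consider "aff_dim F = -1" | "aff_dim F = 0" | "aff_dim F = 1 \<or> aff_dim F = 2" | "aff_dim F = 3"
    | "aff_dim F = 4" by linarith
  then show ?thesis
  proof cases
    case 1
    then have "F1 = {}" "F2 = {}" using f1 f2 aff_dim_empty[of F1] aff_dim_empty[of F2] by auto
    then show ?thesis by simp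
  next
    case 2
    then obtain v w where vw: "F1 = {v}" "F2 = {w}" using f1 f2 aff_dim_eq_0 by metis
    then have ext: "v extreme_point_of Q" "w extreme_point_of Q"
      using f1 f2 by (auto simp: face_of_singleton)
    have "star Q v = star Q w" using up vw by (auto simp: star_def skel_def)
    then have "v = w" using star_inj[OF pQ(1) _ ext] pQ by simp
    then show ?thesis using vw by simp
  next
    case 3
    then have "F1 \<in> skel Q" "F2 \<in> skel Q" using f1 f2 by (auto simp: skel_iff)
    then show ?thesis using up[of F1] up[of F2] by blast
  next
    case 4
    then show ?thesis using facet_determined[OF dim Q] f1 f2 down by simp
  next
    case 5
    then have "F1 = Q" "F2 = Q" using face_dim_eq[OF pQ(1)] f1 f2 pQ by auto
    then show ?thesis by simp
  qed
qed

text \<open>Two distinct nested proper faces that are nonempty and skip the dimensions 1 and 2 have to be a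
  vertex and a facet, and there are edges between them. This is why the relations to edges and polygons
  determine the whole order.\<close>

lemma skel_interpolates:
  fixes P :: "'a::euclidean_space set"
  assumes dim: "DIM('a) = 4" and P: "full_polytope P"
    and F: "F face_of P" "F \<noteq> {}" and G: "G face_of P" "G \<noteq> P" and sub: "F \<subseteq> G" "F \<noteq> G"
  obtains X where "X \<in> skel P" "F \<subseteq> X" "X \<subseteq> G"
proof -
  have pP: "polytope P" "aff_dim P = 4"
    using P dim by (auto simp: full_polytope_def simp flip: aff_dim_eq_full)
  have pG: "polytope G" by (rule face_of_polytope_polytope[OF pP(1) G(1)])
  have "aff_dim F < aff_dim G" by (rule face_proper_dim[OF pP(1) F(1) G(1) sub])
  moreover have "aff_dim G < 4"
    using face_of_aff_dim_lt[OF polytope_imp_convex[OF pP(1)] G] pP by simp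
  moreover have "aff_dim F \<ge> 0" using F(2) aff_dim_geq[of F] aff_dim_empty[of F] by linarith
  ultimately have d: "aff_dim F = 0 \<or> aff_dim F = 1 \<or> aff_dim F = 2" by linarith
  show ?thesis
  proof (cases "aff_dim F = 0")
    case True
    have "F face_of G" using F(1) sub by (simp add: face_of_face[OF G(1)])
    then obtain X where X: "X face_of G" "F \<subseteq> X" "aff_dim X = aff_dim F + 1"
      using face_one_dim_up[OF pG] sub by blast
    then have "X \<in> skel P" using True face_of_trans[OF X(1) G(1)] by (simp add: skel_iff)
    then show ?thesis using that X face_of_imp_subset by blast
  next
    case False
    then have "F \<in> skel P" using d F by (simp add: skel_iff)
    then show ?thesis using that sub by blast
  qed
qed

lemma corresponds_mono:
  fixes P Q :: "'a::euclidean_space set"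
  assumes dim: "DIM('a) = 4" and P: "full_polytope P" and Q: "full_polytope Q"
    and bij: "bij_betw \<phi> (skel P) (skel Q)"
    and F: "corresponds P Q \<phi> F F'" and G: "corresponds P Q \<phi> G G'" and "F \<subseteq> G"
  shows "F' \<subseteq> G'"
proof -
  have f: "F face_of P" "F' face_of Q" "aff_dim F' = aff_dim F"
    and g: "G face_of P" "G' face_of Q" "aff_dim G' = aff_dim G"
    using F G by (auto simp: corresponds_def)
  have pQ: "polytope Q" and dims: "aff_dim P = 4" "aff_dim Q = 4"
    using P Q dim by (auto simp: full_polytope_def simp flip: aff_dim_eq_full)
  consider "F = {}" | "G = P" | "F = G" | "F \<noteq> {}" "G \<noteq> P" "F \<noteq> G" by blast
  then show ?thesis
  proof cases
    case 1
    then have "F' = {}" using f aff_dim_empty[of F] aff_dim_empty[of F'] by simp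
    then show ?thesis by simp
  next
    case 2
    then have "G' = Q" using face_dim_eq[OF pQ g(2)] g dims by simp
    then show ?thesis using f face_of_imp_subset by blast
  next
    case 3
    then show ?thesis using corresponds_unique[OF dim P Q bij F] G by blast
  next
    case 4
    then obtain X where "X \<in> skel P" "F \<subseteq> X" "X \<subseteq> G"
      using skel_interpolates[OF dim P f(1) _ g(1)] \<open>F \<subseteq> G\<close> by blast
    then have "F' \<subseteq> \<phi> X" "\<phi> X \<subseteq> G'" using F G by (auto simp: corresponds_def)
    then show ?thesis by (rule subset_trans)
  qed
qed

theorem theorem3p3:
  fixes P Q :: "(real^4) set"
    and \<phi> :: "(real^4) set \<Rightarrow> (real^4) set"
  assumes "full_polytope P" and "full_polytope Q"
    and "poset_iso (skeleton 1 2 P) (skeleton 1 2 Q) \<phi>"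
  shows "\<exists>\<Phi>. poset_iso (faces P) (faces Q) \<Phi> \<and> (\<forall>F\<in>skeleton 1 2 P. \<Phi> F = \<phi> F)"
proof -
  note P = assms(1) and Q = assms(2)
  have dim: "DIM(real^4) = 4" by simp
  have iso: "poset_iso (skel P) (skel Q) \<phi>"
    using assms(3) unfolding skeleton_eq_skel[OF P] skeleton_eq_skel[OF Q] .
  then have bij: "bij_betw \<phi> (skel P) (skel Q)"
    and ord: "\<And>x y. x \<in> skel P \<Longrightarrow> y \<in> skel P \<Longrightarrow> x \<subseteq> y \<longleftrightarrow> \<phi> x \<subseteq> \<phi> y"
    by (auto simp: poset_iso_def)
  define \<psi> where "\<psi> = inv_into (skel P) \<phi>"
  have iso': "poset_iso (skel Q) (skel P) \<psi>" unfolding \<psi>_def by (rule poset_iso_inv[OF iso])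
  then have bij': "bij_betw \<psi> (skel Q) (skel P)" by (simp add: poset_iso_def)
  have inv_inv: "inv_into (skel Q) \<psi> X = \<phi> X" if "X \<in> skel P" for X
    unfolding \<psi>_def by (rule inv_into_inv_into_eq[OF bij that])
  have forth: "corresponds Q P \<psi> F' F" if "corresponds P Q \<phi> F F'" for F F'
    unfolding \<psi>_def by (rule corresponds_inv[OF bij that])
  have backward: "corresponds P Q \<phi> F F'" if c: "corresponds Q P \<psi> F' F" for F F'
    using corresponds_inv[OF bij' c] inv_inv by (simp add: corresponds_def)
  define \<Phi> where "\<Phi> F = (SOME F'. corresponds P Q \<phi> F F')" for F
  have \<Phi>: "corresponds P Q \<phi> F (\<Phi> F)" if F: "F face_of P" for F
  proof -
    obtain F' where "corresponds P Q \<phi> F F'" using corresponds_exists[OF dim P Q iso F] .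
    then show ?thesis unfolding \<Phi>_def by (rule someI)
  qed
  have mono: "F \<subseteq> G \<longleftrightarrow> \<Phi> F \<subseteq> \<Phi> G" if "F face_of P" "G face_of P" for F G
    using corresponds_mono[OF dim P Q bij \<Phi>[OF that(1)] \<Phi>[OF that(2)]]
      corresponds_mono[OF dim Q P bij' forth[OF \<Phi>[OF that(1)]] forth[OF \<Phi>[OF that(2)]]] by blast
  have "\<exists>F. F face_of P \<and> \<Phi> F = F'" if F': "F' face_of Q" for F'
  proof -
    obtain F where F: "corresponds Q P \<psi> F' F" using corresponds_exists[OF dim Q P iso' F'] .
    then have c: "corresponds P Q \<phi> F F'" by (rule backward)
    then have "F face_of P" by (simp add: corresponds_def)
    then show ?thesis using corresponds_unique[OF dim P Q bij \<Phi> c] by blast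
  qed
  then have surj: "\<Phi> ` {F. F face_of P} = {F. F face_of Q}"
    using \<Phi> by (fastforce simp: corresponds_def)
  have "inj_on \<Phi> {F. F face_of P}" using mono by (intro inj_onI equalityI) auto
  then have "poset_iso (faces P) (faces Q) \<Phi>"
    using surj mono by (simp add: poset_iso_def bij_betw_def faces_eq_face_of P Q)
  moreover have "\<Phi> X = \<phi> X" if X: "X \<in> skel P" for X
  proof -
    have Xf: "X face_of P" using X by (simp add: skel_iff)
    have "X \<subseteq> X \<longleftrightarrow> \<Phi> X \<subseteq> \<phi> X" "X \<subseteq> X \<longleftrightarrow> \<phi> X \<subseteq> \<Phi> X"
      using \<Phi>[OF Xf] X by (auto simp: corresponds_def)
    then show ?thesis by blast
  qed
  ultimately show ?thesis unfolding skeleton_eq_skel[OF P] by blast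
qed

end
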